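(* Let $\mu\in\mathcal M_+$, $\mu\ne\delta_0$, let $\alpha\in(0,1)$ and $L\in\mathcal R_0$. Then $$\mu\big((x,+\infty)\big)\sim x^{-\alpha}L(x)$$ is equivalent to $$S_\mu\left(-\frac1x\right)\sim\left(\frac{\sin(\pi\alpha)}{\pi\alpha}\right)^{1/\alpha}\frac{x^{1-1/\alpha}}{M^{\#}(x^{1/\alpha})},$$ where $M^{\#}$ is a de Bruijn conjugate of the slowly varying function $M:=L^{-1/\alpha}$.
   Context: $\mathcal M_+$ is the set of Borel probability measures on $[0,+\infty)$. $f(x)\sim g(x)$ means $f(x)/g(x)\to1$ as $x\to+\infty$. $\mathcal R_0$ is the class of slowly varying functions: (positive, measurable) $f$ on a neighborhood of $+\infty$ with $f(\lambda x)/f(x)\to1$ as $x\to+\infty$ for every $\lambda>0$. A de Bruijn conjugate of $M\in\mathcal R_0$ is a slowly varying function $M^{\#}$, unique up to asymptotic equivalence, with $M(x)M^{\#}(xM(x))\to1$ and $M^{\#}(x)M(xM^{\#}(x))\to1$ as $x\to+\infty$ (it always exists). For $\mu\in\mathcal M_+$, $\mu\ne\delta_0$, put $\delta=\mu(\{0\})<1$ and $\psi_\mu(z)=\int_{[0,+\infty)}\frac{zt}{1-zt}\,\mu(\mathrm dt)$, $z<0$. The map $\psi_\mu:(-\infty,0)\to(\delta-1,0)$ is invertible with inverse $\chi_\mu$, and the $S$-transform is $S_\mu(z)=\frac{z+1}{z}\chi_\mu(z)$, $z\in(\delta-1,0)$. *)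

theory Defs
  imports "HOL-Probability.Probability" "HOL-Library.Landau_Symbols"
begin

text \<open>Only the behaviour near \<open>+\<infinity>\<close> matters: outside some half-line \<open>[a, \<infinity>)\<close> the total
  function \<open>f\<close> is arbitrary.\<close>

definition slowly_varying :: "(real \<Rightarrow> real) \<Rightarrow> bool" where
  "slowly_varying f \<longleftrightarrow>
     (\<exists>a. f \<in> borel_measurable (restrict_space borel {a..}) \<and> (\<forall>x\<ge>a. f x > 0)) \<and>
     (\<forall>c>0. ((\<lambda>x. f (c * x) / f x) \<longlongrightarrow> 1) at_top)"

text \<open>De Bruijn conjugates are unique only up to asymptotic equivalence, hence a relation:
  \<open>N\<close> is a de Bruijn conjugate of \<open>M\<close>.\<close>

definition de_bruijn_conjugate :: "(real \<Rightarrow> real) \<Rightarrow> (real \<Rightarrow> real) \<Rightarrow> bool" where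
  "de_bruijn_conjugate M N \<longleftrightarrow>
     slowly_varying M \<and> slowly_varying N \<and>
     ((\<lambda>x. M x * N (x * M x)) \<longlongrightarrow> 1) at_top \<and>
     ((\<lambda>x. N x * M (x * N x)) \<longlongrightarrow> 1) at_top"

abbreviation nonneg_borel :: "real measure" where
  "nonneg_borel \<equiv> restrict_space borel {0..}"

definition M_plus :: "real measure set" where
  "M_plus = {\<mu>. prob_space \<mu> \<and> sets \<mu> = sets nonneg_borel}"

definition psi_transform :: "real measure \<Rightarrow> real \<Rightarrow> real" where
  "psi_transform \<mu> z = (LINT t|\<mu>. z * t / (1 - z * t))"

text \<open>The inverse of \<open>psi_transform \<mu> : (-\<infinity>, 0) \<rightarrow> (\<delta> - 1, 0)\<close> with \<open>\<delta> = \<mu> {0}\<close>, for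
  \<open>\<mu> \<in> M_plus\<close> other than the point mass at \<open>0\<close>; \<open>chi_transform \<mu>\<close> and \<open>S_transform \<mu>\<close> are
  meaningful only on \<open>(\<delta> - 1, 0)\<close>.\<close>

definition chi_transform :: "real measure \<Rightarrow> real \<Rightarrow> real" where
  "chi_transform \<mu> = the_inv_into {..<0} (psi_transform \<mu>)"

definition S_transform :: "real measure \<Rightarrow> real \<Rightarrow> real" where
  "S_transform \<mu> z = (z + 1) / z * chi_transform \<mu> z"

end

theory Submission
  imports Defs
begin

text \<open>
  Write \<open>G\<close> for the tail \<open>x \<mapsto> \<mu> (x, \<infinity>)\<close>, put \<open>\<phi> x = -\<psi>(-1/x) = \<integral> t / (x + t) d\<mu>\<close> and
  \<open>c = \<pi>\<alpha> / sin (\<pi>\<alpha>)\<close>.  The function \<open>\<phi>\<close> (called \<open>stieltjes\<close> below) decreases strictly and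
  continuously to \<open>0\<close>, and the proof factors through the condition \<open>\<phi> x \<sim> c x\<^sup>-\<^sup>\<alpha> L x\<close>.

  \<^item> The tail against the transform (\<open>tail_iff_stieltjes\<close>).  Layer-cake integration gives
  \<open>\<phi> x = \<integral>\<^sub>0\<^sup>1 G (x (1 - w) / w) dw\<close>.  If \<open>G\<close> varies regularly, then \<open>G (x v) / G x\<close> tends to
  \<open>v\<^sup>-\<^sup>\<alpha>\<close> and dominated convergence produces the constant \<open>\<integral>\<^sub>0\<^sup>1 ((1 - w) / w)\<^sup>-\<^sup>\<alpha> dw = c\<close>; an
  integrable majorant comes from the monotonicity of \<open>G\<close> and a doubling inequality.
  The converse is Karamata's method.  The substitution \<open>u = x / (x + t)\<close> turns
  \<open>t / (x + t) d\<mu>\<close>, divided by \<open>x\<^sup>-\<^sup>\<alpha> L x\<close>, into a finite measure \<open>K\<^sub>x\<close> on \<open>[0, 1]\<close>, and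
  \<open>\<phi> ((1 - a) x)\<close> into \<open>\<integral> 1 / (1 - a u) dK\<^sub>x = \<Sum>\<^sub>k a\<^sup>k \<integral> u\<^sup>k dK\<^sub>x\<close>.  So the asymptotics of \<open>\<phi>\<close> say that
  these generating functions converge to \<open>c (1 - a)\<^sup>-\<^sup>\<alpha>\<close>, the generating function of a Beta
  measure.  Hence all moments converge, hence, by the Weierstrass approximation theorem, all
  integrals of continuous functions.  As \<open>G x\<close> is \<open>x\<^sup>-\<^sup>\<alpha> L x\<close> times the \<open>K\<^sub>x\<close>-integral of the function
  \<open>u \<mapsto> 1 / (1 - u)\<close> cut off at \<open>u = 1/2\<close>, bracketing the cut-off by continuous ramps gives
  the asymptotics of \<open>G\<close>.

  \<^item> The transform against its inverse.  Put \<open>h = \<phi>\<^sup>-\<^sup>1\<^sup>/\<^sup>\<alpha>\<close>.  The condition on \<open>\<phi>\<close> reads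
  \<open>h x \<sim> c\<^sup>-\<^sup>1\<^sup>/\<^sup>\<alpha> x M x\<close>.  Since \<open>h\<close> is increasing, this is equivalent to
  \<open>h\<^sup>-\<^sup>1 z \<sim> c\<^sup>1\<^sup>/\<^sup>\<alpha> z M\<^sup># z\<close> (\<open>inverse_asymptotics\<close>, used in both directions because the de Bruijn
  conjugate is a symmetric relation).  Finally \<open>S(-1/x) = (x - 1) / h\<^sup>-\<^sup>1 (x\<^sup>1\<^sup>/\<^sup>\<alpha>)\<close>.

  The inversion needs \<open>z M\<^sup># z \<rightarrow> \<infinity>\<close>.  This is where the measurability of slowly varying functions
  enters, through the uniform convergence theorem.
\<close>

section \<open>Slow variation and asymptotic inversion\<close>

text \<open>The uniform convergence theorem of Karamata's theory, in additive notation.  Pointwise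
  convergence implies convergence in mean: \<open>J x = \<integral>\<^sub>0\<^sup>2 min 1 \<bar>h (x + u) - h x\<bar> du\<close> tends to \<open>0\<close> by
  dominated convergence.  For \<open>v\<close> in \<open>[1, 2]\<close>, the increment \<open>h (x + u) - h x\<close> is the difference
  of \<open>h (x + v) - h x\<close> and \<open>h (x + v) - h (x + u)\<close>; averaging over such \<open>v\<close> bounds it by
  \<open>J x + J (x + u)\<close>, uniformly in \<open>u\<close>.\<close>

lemma additive_uniform_convergence:
  fixes h :: "real \<Rightarrow> real"
  assumes [measurable]: "h \<in> borel_measurable borel"
    and lim: "\<And>u. ((\<lambda>x. h (x + u) - h x) \<longlongrightarrow> 0) at_top"
    and "e > 0"
  obtains X where "\<And>x u. x \<ge> X \<Longrightarrow> 0 \<le> u \<Longrightarrow> u \<le> 1 \<Longrightarrow> \<bar>h (x + u) - h x\<bar> < e"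
proof -
  define k where "k = (\<lambda>x u. indicator {0..2} u * min 1 \<bar>h (x + u) - h x\<bar>)"
  define J where "J = (\<lambda>x. LINT u|lborel. k x u)"
  have [measurable]: "k x \<in> borel_measurable borel" for x
    unfolding k_def by measurable
  have k_bound: "norm (k x u) \<le> indicator {0..2} u" for x u
    by (auto simp: k_def indicator_def)
  have k_nonneg: "0 \<le> k x u" for x u
    by (auto simp: k_def indicator_def)
  have w_int: "integrable lborel (indicator {0..2} :: real \<Rightarrow> real)"
    by simp
  have k_int: "integrable lborel (k x)" for x
    by (rule Bochner_Integration.integrable_bound[OF w_int]) (use k_bound in auto)
  have "((\<lambda>x. LINT u|lborel. k x u) \<longlongrightarrow> (LINT u::real|lborel. 0)) at_top"
  proof (rule integral_dominated_convergence_at_top)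
    have "((\<lambda>x. indicator {0..2} u * min 1 \<bar>h (x + u) - h x\<bar>) \<longlongrightarrow> indicator {0..2} u * min 1 \<bar>0\<bar>) at_top"
      for u by (intro tendsto_intros lim)
    then show "AE u in lborel. ((\<lambda>x. k x u) \<longlongrightarrow> 0) at_top"
      by (simp add: k_def)
    show "\<forall>\<^sub>F x in at_top. AE u in lborel. norm (k x u) \<le> indicator {0..2} u"
      using k_bound by simp
  qed (use w_int in auto)
  then have "(J \<longlongrightarrow> 0) at_top"
    by (simp add: J_def)
  moreover have "0 < min 1 e / 2"
    using \<open>e > 0\<close> by simp
  ultimately have "\<forall>\<^sub>F x in at_top. J x < min 1 e / 2"
    by (rule order_tendstoD)
  then obtain X where X: "\<And>x. x \<ge> X \<Longrightarrow> J x < min 1 e / 2"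
    by (auto simp: eventually_at_top_linorder)
  show thesis
  proof (rule that[of X])
    fix x u :: real
    assume x: "x \<ge> X" and u: "0 \<le> u" "u \<le> 1"
    define C where "C = min 1 \<bar>h (x + u) - h x\<bar>"
    \<comment> \<open>Read from the base point \<open>x + u\<close>, the common end point \<open>x + v\<close> has the increment \<open>v - u\<close>.\<close>
    have shift: "J (x + u) = (LINT v|lborel. k (x + u) (v - u))"
      using lborel_integral_real_affine[of 1 "k (x + u)" "- u"] by (simp add: J_def)
    have shift_int: "integrable lborel (\<lambda>v. k (x + u) (v - u))"
      using lborel_integrable_real_affine[OF k_int, of 1 "x + u" "- u"] by simp
    have "(LINT v|lborel. indicator {1..2} (v::real) * C) \<le> (LINT v|lborel. k x v + k (x + u) (v - u))"
    proof (rule integral_mono)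
      show "indicator {1..2} (v::real) * C \<le> k x v + k (x + u) (v - u)" for v
        using u k_nonneg[of x v] k_nonneg[of "x + u" "v - u"]
        by (auto simp: k_def C_def indicator_def)
    qed (use k_int shift_int in auto)
    also have "\<dots> = J x + J (x + u)"
      unfolding shift by (simp add: J_def k_int shift_int)
    finally have "C \<le> J x + J (x + u)"
      by simp
    also have "\<dots> < min 1 e"
      using X[of x] X[of "x + u"] x u by simp
    finally show "\<bar>h (x + u) - h x\<bar> < e"
      by (auto simp: C_def)
  qed
qed

text \<open>In logarithmic coordinates \<open>h y = ln (f (exp y))\<close> has, by uniform convergence, increments of at
  most \<open>1/2\<close> over unit steps, so \<open>y + h y\<close> grows at least like \<open>y / 2\<close>.  Convergence of the
  increments for each fixed step would not exclude ever deeper dips at moving places.\<close>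

lemma slowly_varying_times_id_at_top:
  assumes "slowly_varying f"
  shows "filterlim (\<lambda>x. x * f x) at_top at_top"
proof -
  obtain a where meas: "f \<in> borel_measurable (restrict_space borel {a..})"
    and pos: "\<And>x. x \<ge> a \<Longrightarrow> f x > 0"
    and sv: "\<And>c. c > 0 \<Longrightarrow> ((\<lambda>x. f (c * x) / f x) \<longlongrightarrow> 1) at_top"
    using assms unfolding slowly_varying_def by blast
  define F where "F = (\<lambda>x. if x \<in> {a..} then f x else 1)"
  have [measurable]: "F \<in> borel_measurable borel"
    using meas unfolding F_def by (subst (asm) measurable_restrict_space_iff[where c=1]) auto
  have F_pos: "F x > 0" for x
    using pos by (auto simp: F_def)
  have F_sv: "((\<lambda>x. F (c * x) / F x) \<longlongrightarrow> 1) at_top" if "c > 0" for c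
  proof (rule Lim_transform_eventually[OF sv[OF that]])
    have "\<forall>\<^sub>F x in at_top. x \<ge> a / c \<and> x \<ge> a"
      by (intro eventually_conj eventually_ge_at_top)
    then show "\<forall>\<^sub>F x in at_top. f (c * x) / f x = F (c * x) / F x"
      by eventually_elim (use that in \<open>auto simp: F_def field_simps\<close>)
  qed
  define h where "h = (\<lambda>y. ln (F (exp y)))"
  have h_meas: "h \<in> borel_measurable borel"
    unfolding h_def by measurable
  have h_lim: "((\<lambda>y. h (y + u) - h y) \<longlongrightarrow> 0) at_top" for u
  proof -
    have "((\<lambda>y. ln (F (exp u * exp y) / F (exp y))) \<longlongrightarrow> ln 1) at_top"
      by (intro tendsto_ln filterlim_compose[OF F_sv exp_at_top]) auto
    then show ?thesis
      using F_pos by (simp add: h_def ln_div exp_add mult.commute less_imp_neq[symmetric])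
  qed
  obtain X where X: "\<And>x u. x \<ge> X \<Longrightarrow> 0 \<le> u \<Longrightarrow> u \<le> 1 \<Longrightarrow> \<bar>h (x + u) - h x\<bar> < 1 / 2"
    using additive_uniform_convergence[OF h_meas h_lim, of "1 / 2"] by auto
  have step: "h (X + real n + u) \<ge> h X - (real n + 1) / 2" if "0 \<le> u" "u \<le> 1" for n u
  proof (induction n)
    case 0
    then show ?case using X[of X u] that by (simp add: abs_real_def split: if_splits)
  next
    case (Suc n)
    have "\<bar>h ((X + real n + u) + 1) - h (X + real n + u)\<bar> < 1 / 2"
      using that by (intro X) auto
    then show ?case
      using Suc by (simp add: abs_real_def algebra_simps add_divide_distrib split: if_splits)
  qed
  have lower: "h y \<ge> h X - (y - X + 1) / 2" if "y \<ge> X" for y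
  proof -
    define n where "n = nat \<lfloor>y - X\<rfloor>"
    have n: "real n = of_int \<lfloor>y - X\<rfloor>"
      using that by (simp add: n_def)
    then have "h (X + real n + frac (y - X)) \<ge> h X - (real n + 1) / 2"
      by (intro step) (auto simp: less_imp_le[OF frac_lt_1])
    moreover have "X + real n + frac (y - X) = y"
      by (simp add: n frac_def)
    moreover have "real n \<le> y - X"
      by (simp add: n)
    ultimately show ?thesis
      by (simp add: field_simps)
  qed
  have "filterlim (\<lambda>y. y / 2 + (h X - (1 - X) / 2)) at_top at_top"
    unfolding filterlim_at_top
  proof
    fix Z
    show "\<forall>\<^sub>F y in at_top. Z \<le> y / 2 + (h X - (1 - X) / 2)"
      using eventually_ge_at_top[of "2 * (Z - (h X - (1 - X) / 2))"]
      by eventually_elim (simp add: field_simps)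
  qed
  then have "filterlim (\<lambda>y. y + h y) at_top at_top"
  proof (rule filterlim_at_top_mono)
    show "\<forall>\<^sub>F y in at_top. y / 2 + (h X - (1 - X) / 2) \<le> y + h y"
      using eventually_ge_at_top[of X]
      by eventually_elim (use lower in \<open>fastforce simp: field_simps\<close>)
  qed
  then have "filterlim (\<lambda>x. exp (ln x + h (ln x))) at_top at_top"
    by (intro filterlim_compose[OF exp_at_top] filterlim_compose[OF _ ln_at_top])
  moreover have "\<forall>\<^sub>F x in at_top. exp (ln x + h (ln x)) = x * f x"
    using eventually_ge_at_top[of a] eventually_gt_at_top[of 0]
    by eventually_elim (use pos in \<open>auto simp: h_def F_def exp_add\<close>)
  ultimately show ?thesis
    by (rule filterlim_cong[THEN iffD1, OF refl refl, rotated])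
qed

text \<open>With \<open>p z = z * N z\<close>, conjugacy says \<open>p z * M (p z) \<sim> z\<close>.  Slow variation of \<open>M\<close> then gives
  \<open>f (c / k * p z) \<sim> c * z\<close> for every \<open>c > 0\<close>.  For \<open>c < 1\<close> this is eventually below
  \<open>z = f (g z)\<close>, for \<open>c > 1\<close> above it, and monotonicity of \<open>f\<close> squeezes \<open>g z\<close> between
  \<open>c / k * p z\<close> for constants \<open>c\<close> on both sides of \<open>1\<close>.\<close>

lemma inverse_asymptotics:
  fixes f g M N :: "real \<Rightarrow> real"
  assumes conj: "de_bruijn_conjugate M N" and "k > 0"
    and mono: "strict_mono_on {a..} f"
    and inv: "\<And>y. y \<ge> b \<Longrightarrow> g y \<ge> a \<and> f (g y) = y"
    and lim: "((\<lambda>x. f x / (x * M x)) \<longlongrightarrow> k) at_top"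
  shows "((\<lambda>z. g z / (z * N z)) \<longlongrightarrow> 1 / k) at_top"
proof -
  define p where "p = (\<lambda>z. z * N z)"
  have svM: "slowly_varying M" and svN: "slowly_varying N"
    and NM: "((\<lambda>z. N z * M (p z)) \<longlongrightarrow> 1) at_top"
    using conj by (auto simp: de_bruijn_conjugate_def p_def)
  have p_top: "filterlim p at_top at_top"
    unfolding p_def by (rule slowly_varying_times_id_at_top[OF svN])
  then have ev_p: "\<forall>\<^sub>F z in at_top. Y \<le> p z" for Y
    by (simp add: filterlim_at_top)
  obtain m where M_pos: "\<And>x. x \<ge> m \<Longrightarrow> M x > 0"
    using svM by (auto simp: slowly_varying_def)
  have key: "((\<lambda>z. f (c / k * p z) / z) \<longlongrightarrow> c) at_top" if "c > 0" for c
  proof -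
    have ck: "c / k > 0"
      using that \<open>k > 0\<close> by simp
    have q_top: "filterlim (\<lambda>z. c / k * p z) at_top at_top"
      by (rule filterlim_tendsto_pos_mult_at_top[OF tendsto_const ck p_top])
    have "((\<lambda>z. f (c / k * p z) / (c / k * p z * M (c / k * p z)) * (c / k) *
             (M (c / k * p z) / M (p z)) * (N z * M (p z))) \<longlongrightarrow> k * (c / k) * 1 * 1) at_top"
    proof (intro tendsto_mult tendsto_const NM)
      show "((\<lambda>z. f (c / k * p z) / (c / k * p z * M (c / k * p z))) \<longlongrightarrow> k) at_top"
        by (rule filterlim_compose[OF lim q_top])
      have "((\<lambda>x. M (c / k * x) / M x) \<longlongrightarrow> 1) at_top"
        using svM ck unfolding slowly_varying_def by blast
      from filterlim_compose[OF this p_top]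
      show "((\<lambda>z. M (c / k * p z) / M (p z)) \<longlongrightarrow> 1) at_top" .
    qed
    moreover have "\<forall>\<^sub>F z in at_top. f (c / k * p z) / (c / k * p z * M (c / k * p z)) * (c / k) *
             (M (c / k * p z) / M (p z)) * (N z * M (p z)) = f (c / k * p z) / z"
    proof -
      have "\<forall>\<^sub>F z in at_top. m \<le> c / k * p z"
        using q_top by (simp add: filterlim_at_top)
      with eventually_gt_at_top[of 0] ev_p[of m] ev_p[of 1] show ?thesis
      proof eventually_elim
        case (elim z)
        have "M (p z) > 0" "M (c / k * p z) > 0"
          using M_pos elim by auto
        moreover have "p z > 0" "N z = p z / z"
          using elim by (auto simp: p_def)
        ultimately show ?case
          using elim ck that \<open>k > 0\<close> by (simp add: field_simps)
      qed
    qed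
    ultimately have "((\<lambda>z. f (c / k * p z) / z) \<longlongrightarrow> k * (c / k) * 1 * 1) at_top"
      by (rule Lim_transform_eventually)
    then show ?thesis
      using \<open>k > 0\<close> by simp
  qed
  have ev: "\<forall>\<^sub>F z in at_top. z \<ge> b \<and> z > 0 \<and> p z > 0 \<and> c / k * p z \<ge> a" if "c > 0" for c
  proof -
    have ck: "c / k > 0"
      using that \<open>k > 0\<close> by simp
    have "filterlim (\<lambda>z. c / k * p z) at_top at_top"
      by (rule filterlim_tendsto_pos_mult_at_top[OF tendsto_const ck p_top])
    then have "\<forall>\<^sub>F z in at_top. a \<le> c / k * p z"
      by (simp add: filterlim_at_top)
    with eventually_gt_at_top[of 0] eventually_ge_at_top[of b] ev_p[of 1] show ?thesis
      by eventually_elim auto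
  qed
  have "((\<lambda>z. g z / p z) \<longlongrightarrow> 1 / k) at_top"
  proof (rule order_tendstoI)
    fix l assume "l < 1 / k"
    then have "max 0 (l * k) < 1"
      using \<open>k > 0\<close> by (simp add: field_simps)
    then obtain c where c: "0 < c" "l * k < c" "c < 1"
      using dense by (metis max_less_iff_conj)
    from order_tendstoD(2)[OF key[OF c(1)] c(3)] ev[OF c(1)]
    show "\<forall>\<^sub>F z in at_top. l < g z / p z"
    proof eventually_elim
      case (elim z)
      then have "f (c / k * p z) < f (g z)"
        using inv[of z] by (simp add: field_simps)
      then have "c / k * p z < g z"
        using strict_mono_on_leD[OF mono] elim inv[of z] by (fastforce simp: not_less[symmetric])
      then have "c / k < g z / p z"
        using elim by (simp add: pos_less_divide_eq)
      moreover have "l < c / k"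
        using c \<open>k > 0\<close> by (simp add: field_simps)
      ultimately show ?case by simp
    qed
  next
    fix l assume "1 / k < l"
    then have "1 < l * k"
      using \<open>k > 0\<close> by (simp add: field_simps)
    then obtain c where c: "1 < c" "c < l * k"
      using dense by blast
    then have "c > 0" by simp
    from order_tendstoD(1)[OF key[OF this] c(1)] ev[OF this]
    show "\<forall>\<^sub>F z in at_top. g z / p z < l"
    proof eventually_elim
      case (elim z)
      then have "f (g z) < f (c / k * p z)"
        using inv[of z] by (simp add: field_simps)
      then have "g z < c / k * p z"
        using strict_mono_on_leD[OF mono] elim inv[of z] by (fastforce simp: not_less[symmetric])
      then have "g z / p z < c / k"
        using elim by (simp add: pos_divide_less_eq)
      moreover have "c / k < l"
        using c \<open>k > 0\<close> by (simp add: field_simps)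
      ultimately show ?case by simp
    qed
  qed
  then show ?thesis
    by (simp add: p_def)
qed

section \<open>The transform of a measure and its tail\<close>

text \<open>Up to sign this is \<open>psi_transform\<close> in the variable \<open>-1/x\<close> (\<open>psi_transform_eq_stieltjes\<close>), so that
  the behaviour of the \<open>S\<close>-transform near \<open>0\<close> and that of the tail both concern large \<open>x\<close>.\<close>

definition stieltjes :: "real measure \<Rightarrow> real \<Rightarrow> real" where
  "stieltjes \<mu> x = (LINT t|\<mu>. t / (x + t))"

lemma M_plusD:
  assumes "\<mu> \<in> M_plus"
  shows "prob_space \<mu>" "sets \<mu> = sets nonneg_borel" "space \<mu> = {0..}"
  using assms sets_eq_imp_space_eq[of \<mu> nonneg_borel] by (auto simp: M_plus_def space_restrict_space)

lemma M_plus_measurable: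
  assumes "\<mu> \<in> M_plus" "f \<in> borel_measurable borel"
  shows "f \<in> borel_measurable \<mu>"
  using measurable_restrict_space1[OF assms(2)] M_plusD(2)[OF assms(1)]
  by (subst measurable_cong_sets[OF _ refl]) auto

lemma M_plus_bounded_integrable:
  fixes f :: "real \<Rightarrow> real"
  assumes "\<mu> \<in> M_plus" "f \<in> borel_measurable borel" "\<And>t. t \<ge> 0 \<Longrightarrow> \<bar>f t\<bar> \<le> B"
  shows "integrable \<mu> f"
proof -
  interpret prob_space \<mu> using M_plusD(1)[OF assms(1)] .
  show ?thesis
    by (rule integrable_const_bound[of f B]) (use assms M_plus_measurable M_plusD(3) in auto)
qed

lemma tail_sets:
  assumes "\<mu> \<in> M_plus" "x \<ge> 0"
  shows "{x<..} \<in> sets \<mu>"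
proof -
  have "{x<..} = {0..} \<inter> {x<..}"
    using assms(2) by auto
  then have "{x<..} \<in> sets (restrict_space borel {0..})"
    unfolding sets_restrict_space by (auto intro!: image_eqI[of _ _ "{x<..}"])
  then show ?thesis
    using M_plusD(2)[OF assms(1)] by simp
qed

lemma tail_antimono:
  assumes "\<mu> \<in> M_plus" "0 \<le> x" "x \<le> y"
  shows "measure \<mu> {y<..} \<le> measure \<mu> {x<..}"
proof -
  interpret prob_space \<mu> using M_plusD(1)[OF assms(1)] .
  show ?thesis
    using assms tail_sets[OF assms(1,2)] by (intro finite_measure_mono) auto
qed

lemma tail_le_1: "\<mu> \<in> M_plus \<Longrightarrow> measure \<mu> {x<..} \<le> 1"
  using M_plusD(1) by (simp add: prob_space.prob_le_1)

lemma stieltjes_integrable: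
  assumes "\<mu> \<in> M_plus" "x > 0"
  shows "integrable \<mu> (\<lambda>t. t / (x + t))"
  by (rule M_plus_bounded_integrable[OF assms(1), of _ 1]) (use assms(2) in \<open>auto simp: field_simps\<close>)

lemma psi_transform_eq_stieltjes:
  assumes "x > 0"
  shows "psi_transform \<mu> (- 1 / x) = - stieltjes \<mu> x"
proof -
  have "- 1 / x * t / (1 - - 1 / x * t) = - (t / (x + t))" for t
    using assms by (cases "x + t = 0") (auto simp: field_simps)
  then show ?thesis
    unfolding psi_transform_def stieltjes_def by (simp only: Bochner_Integration.integral_minus)
qed

lemma M_plus_not_AE_zero:
  assumes "\<mu> \<in> M_plus" "\<mu> \<noteq> return nonneg_borel 0"
  shows "\<not> (AE t in \<mu>. t = 0)"
proof
  interpret prob_space \<mu> using M_plusD(1)[OF assms(1)] .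
  assume ae: "AE t in \<mu>. t = 0"
  have "\<mu> = return nonneg_borel 0"
  proof (rule measure_eqI)
    fix A assume A: "A \<in> sets \<mu>"
    then have A': "A \<in> sets nonneg_borel"
      using M_plusD(2)[OF assms(1)] by simp
    have "emeasure \<mu> A = indicator A 0"
    proof (cases "0 \<in> A")
      case True
      then have "AE t in \<mu>. t \<in> A"
        using ae by auto
      then show ?thesis
        using A True by (simp add: emeasure_eq_1_AE)
    next
      case False
      then have "AE t in \<mu>. t \<notin> A"
        using ae by auto
      then show ?thesis
        using A False by (simp add: AE_iff_null_sets null_setsD1)
    qed
    then show "emeasure \<mu> A = emeasure (return nonneg_borel 0) A"
      using A' by simp
  qed (simp add: M_plusD(2)[OF assms(1)])
  then show False using assms(2) by contradiction
qed

lemma stieltjes_strict_antimono: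
  assumes "\<mu> \<in> M_plus" "\<mu> \<noteq> return nonneg_borel 0" "0 < x" "x < y"
  shows "stieltjes \<mu> y < stieltjes \<mu> x"
proof -
  let ?f = "\<lambda>t. t / (x + t) - t / (y + t)"
  have nonneg: "0 \<le> ?f t" if "t \<ge> 0" for t
    using that assms(3,4) by (simp add: frac_le)
  have pos: "?f t \<noteq> 0" if "t \<ge> 0" "t \<noteq> 0" for t
    using divide_strict_left_mono[of "x + t" "y + t" t] that assms(3,4) by simp
  have int: "integrable \<mu> ?f"
    using assms by (intro Bochner_Integration.integrable_diff stieltjes_integrable) auto
  have ae: "AE t in \<mu>. 0 \<le> ?f t"
    using nonneg M_plusD(3)[OF assms(1)] by (intro AE_I2) auto
  have "(LINT t|\<mu>. ?f t) \<noteq> 0"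
  proof
    assume "(LINT t|\<mu>. ?f t) = 0"
    then have "AE t in \<mu>. ?f t = 0"
      using integral_nonneg_eq_0_iff_AE[OF int ae] by simp
    then have "AE t in \<mu>. t = 0"
    proof (rule AE_mp, intro AE_I2 impI)
      fix t assume "t \<in> space \<mu>" "?f t = 0"
      then show "t = 0" using pos[of t] M_plusD(3)[OF assms(1)] by auto
    qed
    then show False
      using M_plus_not_AE_zero[OF assms(1,2)] by contradiction
  qed
  moreover have "(LINT t|\<mu>. ?f t) \<ge> 0"
    using ae by (rule integral_nonneg_AE)
  moreover have "(LINT t|\<mu>. ?f t) = stieltjes \<mu> x - stieltjes \<mu> y"
    unfolding stieltjes_def using assms by (intro Bochner_Integration.integral_diff stieltjes_integrable) auto
  ultimately show ?thesis by simp
qed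

lemma stieltjes_nonneg:
  assumes "\<mu> \<in> M_plus" "x > 0"
  shows "stieltjes \<mu> x \<ge> 0"
  unfolding stieltjes_def using assms(2) M_plusD(3)[OF assms(1)]
  by (intro integral_nonneg_AE AE_I2) auto

lemma stieltjes_pos:
  assumes "\<mu> \<in> M_plus" "\<mu> \<noteq> return nonneg_borel 0" "0 < x"
  shows "stieltjes \<mu> x > 0"
  using stieltjes_strict_antimono[OF assms, of "x + 1"] stieltjes_nonneg[of \<mu> "x + 1"] assms by simp

lemma stieltjes_tendsto_0:
  assumes "\<mu> \<in> M_plus"
  shows "(stieltjes \<mu> \<longlongrightarrow> 0) at_top"
proof -
  interpret prob_space \<mu> using M_plusD(1)[OF assms(1)] .
  have "((\<lambda>x. LINT t|\<mu>. t / (x + t)) \<longlongrightarrow> (LINT t|\<mu>. 0)) at_top"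
  proof (rule integral_dominated_convergence_at_top[where w = "\<lambda>_. 1"])
    show "AE t in \<mu>. ((\<lambda>x. t / (x + t)) \<longlongrightarrow> 0) at_top"
      using filterlim_tendsto_add_at_top[OF tendsto_const filterlim_ident]
      by (intro AE_I2 tendsto_divide_0[OF tendsto_const] filterlim_at_top_imp_at_infinity)
         (simp add: add.commute)
    show "\<forall>\<^sub>F x in at_top. AE t in \<mu>. norm (t / (x + t)) \<le> 1"
      using eventually_gt_at_top[of 0]
    proof eventually_elim
      case (elim x)
      then show ?case
        using M_plusD(3)[OF assms(1)] by (intro AE_I2) (auto simp: field_simps)
    qed
  qed (auto intro: M_plus_measurable[OF assms])
  then show ?thesis
    by (simp add: stieltjes_def[abs_def])
qed

text \<open>On \<open>[1, \<infinity>)\<close> the kernel \<open>t / (x + t)\<close> is \<open>1\<close>-Lipschitz in \<open>x\<close>, uniformly in \<open>t\<close>.\<close>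

lemma stieltjes_continuous_on:
  assumes "\<mu> \<in> M_plus"
  shows "continuous_on {1..} (stieltjes \<mu>)"
proof -
  interpret prob_space \<mu> using M_plusD(1)[OF assms(1)] .
  have "\<bar>stieltjes \<mu> x - stieltjes \<mu> y\<bar> \<le> \<bar>x - y\<bar>" if "x \<ge> 1" "y \<ge> 1" for x y
  proof -
    have "stieltjes \<mu> x - stieltjes \<mu> y = (LINT t|\<mu>. t / (x + t) - t / (y + t))"
      unfolding stieltjes_def using assms that
      by (subst Bochner_Integration.integral_diff) (auto intro!: stieltjes_integrable)
    also have "\<bar>\<dots>\<bar> \<le> (LINT t|\<mu>. \<bar>x - y\<bar>)"
    proof (rule order.trans[OF integral_abs_bound integral_mono])
      show "integrable \<mu> (\<lambda>t. \<bar>t / (x + t) - t / (y + t)\<bar>)"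
        using assms that
        by (intro integrable_abs Bochner_Integration.integrable_diff stieltjes_integrable) auto
      fix t assume "t \<in> space \<mu>"
      then have t: "t \<ge> 0" using M_plusD(3)[OF assms] by simp
      have "t / (x + t) - t / (y + t) = (y - x) * (t / (x + t)) * (1 / (y + t))"
        using that t by (simp add: field_simps)
      also have "\<bar>\<dots>\<bar> = \<bar>x - y\<bar> * (t / (x + t)) * (1 / (y + t))"
        using that t by (simp add: abs_mult abs_minus_commute)
      also have "\<dots> \<le> \<bar>x - y\<bar> * 1 * 1"
        using that t by (intro mult_mono) auto
      finally show "\<bar>t / (x + t) - t / (y + t)\<bar> \<le> \<bar>x - y\<bar>" by simp
    qed auto
    finally show ?thesis by (simp add: prob_space)
  qed
  then have "1-lipschitz_on {1..} (stieltjes \<mu>)"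
    by (intro lipschitz_onI) (auto simp: dist_real_def)
  then show ?thesis
    by (rule lipschitz_on_continuous_on)
qed

lemma stieltjes_surj:
  assumes "\<mu> \<in> M_plus" "\<mu> \<noteq> return nonneg_borel 0" "0 < p" "p \<le> stieltjes \<mu> 1"
  obtains x where "x \<ge> 1" "stieltjes \<mu> x = p"
proof -
  have "\<forall>\<^sub>F x in at_top. stieltjes \<mu> x < p \<and> x \<ge> 1"
    using stieltjes_tendsto_0[OF assms(1)] assms(3)
    by (intro eventually_conj order_tendstoD eventually_ge_at_top)
  then obtain y where y: "stieltjes \<mu> y < p" "y \<ge> 1"
    by (auto simp: eventually_at_top_linorder)
  have "\<exists>x. 1 \<le> x \<and> x \<le> y \<and> stieltjes \<mu> x = p"
    using y assms(4) continuous_on_subset[OF stieltjes_continuous_on[OF assms(1)], of "{1..y}"]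
    by (intro IVT2') auto
  then show thesis using that by blast
qed

text \<open>For \<open>0 < w < 1\<close> the inequality \<open>x (1 - w) / w < t\<close> means \<open>x / (x + t) < w\<close>, which holds on an
  interval of length \<open>t / (x + t)\<close>.  So both sides are the measure of the region \<open>?S\<close> below,
  sliced in the two directions.\<close>

lemma stieltjes_eq_tail_integral:
  assumes "\<mu> \<in> M_plus" "x > 0"
  shows "stieltjes \<mu> x = (LINT w|lborel. indicator {0<..<1} w * measure \<mu> {x * ((1 - w) / w)<..})"
proof -
  interpret prob_space \<mu> using M_plusD(1)[OF assms(1)] .
  interpret pair_sigma_finite \<mu> lborel ..
  let ?S = "{(t, w). 0 < w \<and> w < 1 \<and> x * ((1 - w) / w) < t}"
  have [measurable]: "(\<lambda>t::real. t) \<in> borel_measurable \<mu>"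
    by (rule M_plus_measurable[OF assms(1)]) simp
  have iff: "x * ((1 - w) / w) < t \<longleftrightarrow> x / (x + t) < w" if "0 < w" "w < 1" "t \<ge> 0" for t w
    using that assms(2) by (simp add: field_simps)
  have inner_w: "(\<integral>\<^sup>+w. indicator ?S (t, w) \<partial>lborel) = ennreal (t / (x + t))" if "t \<in> space \<mu>" for t
  proof -
    have t: "t \<ge> 0" using that M_plusD(3)[OF assms(1)] by simp
    have "(\<integral>\<^sup>+w. indicator ?S (t, w) \<partial>lborel) = (\<integral>\<^sup>+w. indicator {x / (x + t)<..<1} w \<partial>lborel)"
    proof (rule nn_integral_cong)
      fix w :: real
      have "x / (x + t) > 0" using t assms(2) by simp
      then have "w > 0" if "w > x / (x + t)" using that by (rule less_trans)
      then show "(indicator ?S (t, w) :: ennreal) = indicator {x / (x + t)<..<1} w"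
        using iff[OF _ _ t, of w] by (auto simp: indicator_def)
    qed
    also have "\<dots> = ennreal (1 - x / (x + t))"
      using t assms(2) by simp
    also have "1 - x / (x + t) = t / (x + t)"
      using t assms(2) by (simp add: field_simps)
    finally show ?thesis .
  qed
  have inner_t: "(\<integral>\<^sup>+t. indicator ?S (t, w) \<partial>\<mu>) =
      ennreal (indicator {0<..<1} w * measure \<mu> {x * ((1 - w) / w)<..})" for w
  proof (cases "0 < w \<and> w < 1")
    case True
    then have "{x * ((1 - w) / w)<..} \<in> sets \<mu>"
      using assms by (intro tail_sets) auto
    moreover have "(\<integral>\<^sup>+t. indicator ?S (t, w) \<partial>\<mu>) = (\<integral>\<^sup>+t. indicator {x * ((1 - w) / w)<..} t \<partial>\<mu>)"
      using True by (intro nn_integral_cong) (auto simp: indicator_def)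
    ultimately show ?thesis
      using True by (simp add: emeasure_eq_measure)
  next
    case False
    then have "(\<integral>\<^sup>+t. indicator ?S (t, w) \<partial>\<mu>) = (\<integral>\<^sup>+t. 0 \<partial>\<mu>)"
      by (intro nn_integral_cong) (auto simp: indicator_def)
    then show ?thesis using False by auto
  qed
  have meas: "(\<lambda>p. indicator ?S p :: ennreal) \<in> borel_measurable (\<mu> \<Otimes>\<^sub>M lborel)"
    by measurable
  have "(\<lambda>w. enn2real (\<integral>\<^sup>+t. indicator ?S (t, w) \<partial>\<mu>)) \<in> borel_measurable lborel"
    using meas by measurable
  then have meas': "(\<lambda>w. indicator {0<..<1} w * measure \<mu> {x * ((1 - w) / w)<..}) \<in> borel_measurable lborel"
    unfolding inner_t by simp
  have "ennreal (stieltjes \<mu> x) = (\<integral>\<^sup>+t. ennreal (t / (x + t)) \<partial>\<mu>)"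
    unfolding stieltjes_def using stieltjes_integrable[OF assms] assms(2) M_plusD(3)[OF assms(1)]
    by (intro nn_integral_eq_integral[symmetric] AE_I2) auto
  also have "\<dots> = (\<integral>\<^sup>+t. (\<integral>\<^sup>+w. indicator ?S (t, w) \<partial>lborel) \<partial>\<mu>)"
    using inner_w by (intro nn_integral_cong) auto
  also have "\<dots> = (\<integral>\<^sup>+w. (\<integral>\<^sup>+t. indicator ?S (t, w) \<partial>\<mu>) \<partial>lborel)"
    by (rule Fubini'[symmetric]) (use meas in simp)
  finally have "ennreal (stieltjes \<mu> x) =
      (\<integral>\<^sup>+w. ennreal (indicator {0<..<1} w * measure \<mu> {x * ((1 - w) / w)<..}) \<partial>lborel)"
    unfolding inner_t .
  then have "stieltjes \<mu> x =
      enn2real (\<integral>\<^sup>+w. ennreal (indicator {0<..<1} w * measure \<mu> {x * ((1 - w) / w)<..}) \<partial>lborel)"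
    using stieltjes_nonneg[OF assms] by (metis enn2real_ennreal)
  then show ?thesis
    using meas' by (simp add: integral_eq_nn_integral)
qed

section \<open>From the tail to the transform\<close>

lemma Gamma_reflection_real:
  fixes x :: real
  shows "Gamma x * Gamma (1 - x) = pi / sin (pi * x)"
proof -
  have "complex_of_real (Gamma x * Gamma (1 - x)) = Gamma (of_real x) * Gamma (1 - of_real x)"
    by (simp only: of_real_mult of_real_diff of_real_1 Gamma_complex_of_real[symmetric])
  also have "\<dots> = of_real (pi / sin (pi * x))"
    by (subst Gamma_reflection_complex) (simp only: sin_of_real[symmetric] of_real_mult of_real_divide)
  finally show ?thesis
    unfolding of_real_eq_iff .
qed

text \<open>Up to the constant, the moments of a Beta distribution with parameters \<open>\<alpha>\<close> and \<open>1 - \<alpha>\<close> are the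
  coefficients of the binomial series of \<open>(1 - a)\<^sup>-\<^sup>\<alpha>\<close>; this identifies the limit measure in the
  Tauberian argument.\<close>

lemma Beta_moment:
  fixes \<alpha> :: real
  assumes "0 < \<alpha>" "\<alpha> < 1"
  shows "\<alpha> * Beta (\<alpha> + real k) (1 - \<alpha>) =
    pi * \<alpha> / sin (pi * \<alpha>) * ((-1) ^ k * ((- \<alpha>) gchoose k))"
proof -
  have \<alpha>: "\<alpha> \<notin> \<int>\<^sub>\<le>\<^sub>0"
    using assms by (auto elim!: nonpos_Ints_cases)
  have "Gamma (\<alpha> + real k) = pochhammer \<alpha> k * Gamma \<alpha>"
    using pochhammer_Gamma[OF \<alpha>, of k] Gamma_real_pos[OF assms(1)] by (simp add: field_simps)
  moreover have "Gamma (1 + real k) = fact k"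
    by (simp add: Gamma_fact)
  moreover have "(-1) ^ k * ((- \<alpha>) gchoose k) = pochhammer \<alpha> k / fact k"
    by (simp add: gbinomial_pochhammer flip: power_mult_distrib)
  ultimately have "\<alpha> * Beta (\<alpha> + real k) (1 - \<alpha>) =
      \<alpha> * (Gamma \<alpha> * Gamma (1 - \<alpha>)) * ((-1) ^ k * ((- \<alpha>) gchoose k))"
    by (simp add: Beta_def add.commute)
  then show ?thesis
    by (simp add: Gamma_reflection_real)
qed

lemma Beta_reflection:
  fixes \<alpha> :: real
  assumes "0 < \<alpha>" "\<alpha> < 1"
  shows "Beta (1 + \<alpha>) (1 - \<alpha>) = pi * \<alpha> / sin (pi * \<alpha>)"
proof -
  have "\<alpha> \<notin> \<int>\<^sub>\<le>\<^sub>0"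
    using assms by (auto elim!: nonpos_Ints_cases)
  then have "Beta (1 + \<alpha>) (1 - \<alpha>) = \<alpha> * (Gamma \<alpha> * Gamma (1 - \<alpha>))"
    using Gamma_plus1[of \<alpha>] Gamma_fact[of 1, where 'a = real] by (simp add: Beta_def add.commute)
  then show ?thesis
    by (simp add: Gamma_reflection_real)
qed

text \<open>The cut-off at \<open>0\<close> keeps the half-line inside the space of \<open>\<mu>\<close>; sets that are not measurable
  have measure \<open>0\<close>, which would break monotonicity.\<close>

lemma tail_measurable:
  assumes "\<mu> \<in> M_plus"
  shows "(\<lambda>y. measure \<mu> {max 0 y<..}) \<in> borel_measurable borel"
proof -
  have "mono (\<lambda>y. - measure \<mu> {max 0 y<..})"
    using tail_antimono[OF assms] by (intro monoI) auto
  then have "(\<lambda>y. - (- measure \<mu> {max 0 y<..})) \<in> borel_measurable borel"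
    by (intro borel_measurable_uminus borel_measurable_mono)
  then show ?thesis by simp
qed

text \<open>A bound of Potter type: a decreasing function that loses at most the factor \<open>2\<^sup>\<beta>\<close> under doubling
  decays at most like \<open>x\<^sup>-\<^sup>\<beta>\<close>, up to one further factor \<open>2\<^sup>\<beta>\<close> for the incomplete last doubling.\<close>

lemma doubling_imp_power_bound:
  fixes G :: "real \<Rightarrow> real"
  assumes anti: "\<And>x y. 0 < x \<Longrightarrow> x \<le> y \<Longrightarrow> G y \<le> G x" and "X > 0" "\<beta> \<ge> 0"
    and double: "\<And>z. z \<ge> X \<Longrightarrow> G z \<le> 2 powr \<beta> * G (2 * z)"
    and nonneg: "\<And>z. z > 0 \<Longrightarrow> G z \<ge> 0"
    and "X \<le> y" "y \<le> x"
  shows "y powr \<beta> * G y \<le> 2 powr \<beta> * (x powr \<beta> * G x)"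
proof -
  have "y powr \<beta> * G y \<le> 2 powr \<beta> * (x powr \<beta> * G x)"
    if "X \<le> y" "y \<le> x" "x \<le> 2 ^ n * y" for n
    using that
  proof (induction n arbitrary: y)
    case 0
    then have "y = x" by simp
    moreover have "1 * (x powr \<beta> * G x) \<le> 2 powr \<beta> * (x powr \<beta> * G x)"
      using assms(2,3) nonneg[of x] 0 by (intro mult_right_mono) (auto simp: ge_one_powr_ge_zero)
    ultimately show ?case by simp
  next
    case (Suc n)
    have "y powr \<beta> * G y \<le> y powr \<beta> * (2 powr \<beta> * G (2 * y))"
      using double[of y] Suc.prems by (intro mult_left_mono) auto
    also have "\<dots> = 2 powr \<beta> * (y powr \<beta> * G (2 * y))" by simp
    also have "\<dots> \<le> 2 powr \<beta> * (x powr \<beta> * G x)"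
    proof (cases "x \<le> 2 * y")
      case True
      have "G (2 * y) \<le> G x" "0 \<le> G (2 * y)" "y powr \<beta> \<le> x powr \<beta>"
        using anti[of x "2 * y"] nonneg[of "2 * y"] True Suc.prems assms(2,3) by (auto intro!: powr_mono2)
      then show ?thesis
        by (intro mult_left_mono mult_mono) auto
    next
      case False
      then have "(2 * y) powr \<beta> * G (2 * y) \<le> 2 powr \<beta> * (x powr \<beta> * G x)"
        using Suc.prems \<open>X > 0\<close> by (intro Suc.IH) auto
      then show ?thesis
        using Suc.prems \<open>X > 0\<close> by (simp add: powr_mult)
    qed
    finally show ?case .
  qed
  moreover obtain n where "x / y < 2 ^ n"
    using real_arch_pow[of 2 "x / y"] by auto
  then have "x \<le> 2 ^ n * y"
    using assms(2,6) by (simp add: pos_divide_less_eq less_imp_le)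
  ultimately show ?thesis
    using assms(6,7) by blast
qed

text \<open>Dominated convergence in \<open>stieltjes_eq_tail_integral\<close>.  Substituting \<open>v = (1 - w) / w\<close>, the
  integrand \<open>G (x v) / G x\<close> is at most \<open>1\<close> for \<open>v \<ge> 1\<close>.  For small \<open>v\<close> it is bounded by a multiple of
  \<open>v\<^sup>-\<^sup>\<beta>\<close> for any fixed \<open>\<beta>\<close> strictly between \<open>\<alpha>\<close> and \<open>1\<close>: the gap above \<open>\<alpha>\<close> yields the doubling
  inequality, and \<open>\<beta> < 1\<close> makes the bound integrable.\<close>

theorem stieltjes_abelian:
  assumes \<mu>: "\<mu> \<in> M_plus" and \<alpha>: "0 < \<alpha>" "\<alpha> < 1"
    and pos: "\<And>x. x > 0 \<Longrightarrow> measure \<mu> {x<..} > 0"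
    and rv: "\<And>c. c > 0 \<Longrightarrow> ((\<lambda>x. measure \<mu> {c * x<..} / measure \<mu> {x<..}) \<longlongrightarrow> c powr - \<alpha>) at_top"
  shows "((\<lambda>x. stieltjes \<mu> x / measure \<mu> {x<..}) \<longlongrightarrow> pi * \<alpha> / sin (pi * \<alpha>)) at_top"
proof -
  define G where "G = (\<lambda>x. measure \<mu> {x<..})"
  have G_anti: "G y \<le> G x" if "0 < x" "x \<le> y" for x y
    using that tail_antimono[OF \<mu>] by (simp add: G_def)
  have G_pos: "G x > 0" if "x > 0" for x
    using pos[OF that] by (simp add: G_def)
  have G_le_1: "G x \<le> 1" for x
    using tail_le_1[OF \<mu>] by (simp add: G_def)
  obtain \<beta> where \<beta>: "\<alpha> < \<beta>" "\<beta> < 1"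
    using dense[OF \<alpha>(2)] by blast
  have "(2::real) powr - \<beta> < 2 powr - \<alpha>"
    using \<beta> by simp
  then have "\<forall>\<^sub>F x in at_top. 2 powr - \<beta> < G (2 * x) / G x \<and> x > 0"
    using order_tendstoD(1)[OF rv[of 2]] by (intro eventually_conj eventually_gt_at_top) (auto simp: G_def)
  then obtain X where X: "\<And>x. x \<ge> X \<Longrightarrow> 2 powr - \<beta> < G (2 * x) / G x \<and> x > 0"
    unfolding eventually_at_top_linorder by blast
  have X_pos: "X > 0" using X[of X] by simp
  have double: "G z \<le> 2 powr \<beta> * G (2 * z)" if "z \<ge> X" for z
  proof -
    have "2 powr - \<beta> * G z \<le> G (2 * z)"
      using X[OF that] G_pos[of z] by (simp add: pos_less_divide_eq)
    then have "2 powr \<beta> * (2 powr - \<beta> * G z) \<le> 2 powr \<beta> * G (2 * z)"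
      by (intro mult_left_mono) auto
    then show ?thesis by (simp add: powr_minus field_simps)
  qed
  have potter: "y powr \<beta> * G y \<le> 2 powr \<beta> * (x powr \<beta> * G x)" if "X \<le> y" "y \<le> x" for x y
    using that \<beta> \<alpha> X_pos G_anti G_pos double
    by (intro doubling_imp_power_bound[where X = X]) (auto intro: less_imp_le)
  \<comment> \<open>The factor \<open>1 / G X\<close> covers the arguments \<open>x v < X\<close>, where only \<open>G \<le> 1\<close> is known.\<close>
  define K where "K = 2 powr \<beta> / G X"
  have K: "K \<ge> 2 powr \<beta>"
    using G_pos[OF X_pos] G_le_1[of X] by (simp add: K_def field_simps)
  have K_pos: "K > 0" using K less_le_trans[of 0 "2 powr \<beta>" K] by simp
  have bound: "G (x * v) / G x \<le> K * v powr - \<beta> + 1" if x: "x \<ge> X" and v: "v > 0" for x v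
  proof -
    have x_pos: "x > 0" using x X_pos by simp
    consider "v \<ge> 1" | "v < 1" "x * v \<ge> X" | "v < 1" "x * v < X" by linarith
    then show ?thesis
    proof cases
      case 1
      then have "G (x * v) \<le> G x" using x_pos by (intro G_anti) auto
      then have "G (x * v) / G x \<le> 1" using G_pos[OF x_pos] by simp
      moreover have "0 \<le> K * v powr - \<beta>" using K_pos by simp
      ultimately show ?thesis by linarith
    next
      case 2
      then have "(x * v) powr \<beta> * G (x * v) \<le> 2 powr \<beta> * (x powr \<beta> * G x)"
        using x_pos by (intro potter) auto
      then have "v powr \<beta> * G (x * v) \<le> 2 powr \<beta> * G x"
        using x_pos v by (simp add: powr_mult)
      then have "G (x * v) / G x \<le> 2 powr \<beta> * v powr - \<beta>"
        using G_pos[OF x_pos] v by (simp add: powr_minus field_simps)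
      also have "\<dots> \<le> K * v powr - \<beta>"
        using K by (intro mult_right_mono) auto
      finally show ?thesis by simp
    next
      case 3
      have "X powr \<beta> * G X \<le> 2 powr \<beta> * (x powr \<beta> * G x)"
        using x by (intro potter) auto
      then have "1 / G x \<le> K * (x powr \<beta> / X powr \<beta>)"
        using G_pos[OF x_pos] G_pos[OF X_pos] X_pos by (simp add: K_def field_simps)
      moreover have "x powr \<beta> / X powr \<beta> \<le> v powr - \<beta>"
      proof -
        have "x powr \<beta> / X powr \<beta> = (x / X) powr \<beta>"
          using x_pos X_pos by (simp add: powr_divide)
        also have "\<dots> \<le> (1 / v) powr \<beta>"
          using 3 v x_pos X_pos \<alpha> \<beta> by (intro powr_mono2) (auto simp: field_simps)
        also have "\<dots> = v powr - \<beta>"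
          using v by (simp add: powr_minus powr_divide field_simps)
        finally show ?thesis .
      qed
      then have "K * (x powr \<beta> / X powr \<beta>) \<le> K * v powr - \<beta>"
        using K_pos by (intro mult_left_mono) auto
      moreover have "G (x * v) / G x \<le> 1 / G x"
        using G_le_1 G_pos[OF x_pos] by (simp add: divide_right_mono less_imp_le)
      ultimately show ?thesis by linarith
    qed
  qed
  define B where "B = (\<lambda>b w::real. indicator {0..1} w *\<^sub>R (w powr (1 + b - 1) * (1 - w) powr (1 - b - 1)))"
  have B_int: "integrable lborel (B b)" if "0 < b" "b < 1" for b
    using integrable_Beta[of "1 + b" "1 - b"] that by (simp add: B_def set_integrable_def)
  have B_val: "(LINT w|lborel. B b w) = Beta (1 + b) (1 - b)" if "0 < b" "b < 1" for b
    using set_borel_integral_eq_integral(2)[OF integrable_Beta, of "1 + b" "1 - b"]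
      integral_unique[OF has_integral_Beta_real, of "1 + b" "1 - b"] that
    by (simp add: B_def set_lebesgue_integral_def)
  have B_eq: "B b w = ((1 - w) / w) powr - b" if "0 < w" "w < 1" for b w
    using that by (simp add: B_def powr_divide powr_minus field_simps)
  define s where "s = (\<lambda>x w. indicator {0<..<1} w * (measure \<mu> {max 0 (x * ((1 - w) / w))<..} / G x))"
  have [measurable]: "(\<lambda>y. measure \<mu> {max 0 y<..}) \<in> borel_measurable borel"
    by (rule tail_measurable[OF \<mu>])
  have s_meas: "s x \<in> borel_measurable lborel" for x
    unfolding s_def by measurable
  have s_eq: "s x w = indicator {0<..<1} w * (G (x * ((1 - w) / w)) / G x)" if "x > 0" for x w
    using that by (auto simp: s_def G_def indicator_def max_def zero_le_mult_iff zero_le_divide_iff)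
  have "((\<lambda>x. LINT w|lborel. s x w) \<longlongrightarrow> (LINT w|lborel. B \<alpha> w)) at_top"
  proof (rule integral_dominated_convergence_at_top[where w = "\<lambda>w. K * B \<beta> w + indicator {0..1} w"])
    show "AE w in lborel. ((\<lambda>x. s x w) \<longlongrightarrow> B \<alpha> w) at_top"
    proof (rule AE_I2)
      fix w :: real
      show "((\<lambda>x. s x w) \<longlongrightarrow> B \<alpha> w) at_top"
      proof (cases "0 < w \<and> w < 1")
        case True
        have "((\<lambda>x. G (x * ((1 - w) / w)) / G x) \<longlongrightarrow> B \<alpha> w) at_top"
          using True rv[of "(1 - w) / w"] B_eq[of w \<alpha>] by (simp add: G_def mult.commute)
        moreover have "\<forall>\<^sub>F x in at_top. G (x * ((1 - w) / w)) / G x = s x w"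
          using eventually_gt_at_top[of 0] by eventually_elim (use True s_eq in simp)
        ultimately show ?thesis by (rule Lim_transform_eventually)
      next
        case False
        then have "B \<alpha> w = 0" by (auto simp: B_def indicator_def)
        then show ?thesis using False by (simp add: s_def)
      qed
    qed
    show "\<forall>\<^sub>F x in at_top. AE w in lborel. norm (s x w) \<le> K * B \<beta> w + indicator {0..1} w"
      using eventually_ge_at_top[of X]
    proof eventually_elim
      case (elim x)
      show ?case
      proof (rule AE_I2)
        fix w :: real
        have x_pos: "x > 0" using elim X_pos by simp
        show "norm (s x w) \<le> K * B \<beta> w + indicator {0..1} w"
        proof (cases "0 < w \<and> w < 1")
          case True
          then have "norm (s x w) = G (x * ((1 - w) / w)) / G x"
            using G_pos x_pos by (simp add: s_eq less_imp_le)
          also have "\<dots> \<le> K * ((1 - w) / w) powr - \<beta> + 1"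
            using True by (intro bound elim) auto
          finally show ?thesis
            using True B_eq[of w \<beta>] by simp
        next
          case False
          moreover have "0 \<le> B \<beta> w" by (simp add: B_def)
          ultimately show ?thesis using K_pos by (auto simp: s_def)
        qed
      qed
    qed
    show "integrable lborel (\<lambda>w. K * B \<beta> w + indicator {0..1} w)"
      using B_int[of \<beta>] \<alpha> \<beta> by simp
    show "B \<alpha> \<in> borel_measurable lborel"
      using B_int[OF \<alpha>] by (rule borel_measurable_integrable)
  qed (use s_meas in auto)
  moreover have "\<forall>\<^sub>F x in at_top. (LINT w|lborel. s x w) = stieltjes \<mu> x / G x"
    using eventually_gt_at_top[of 0]
  proof eventually_elim
    case (elim x)
    have "(LINT w|lborel. s x w) = (LINT w|lborel. indicator {0<..<1} w * G (x * ((1 - w) / w)) / G x)"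
      using elim by (simp add: s_eq)
    also have "\<dots> = stieltjes \<mu> x / G x"
      using stieltjes_eq_tail_integral[OF \<mu> elim] by (simp add: G_def)
    finally show ?case .
  qed
  ultimately have "((\<lambda>x. stieltjes \<mu> x / G x) \<longlongrightarrow> (LINT w|lborel. B \<alpha> w)) at_top"
    by (rule Lim_transform_eventually)
  then show ?thesis
    by (simp add: B_val[OF \<alpha>] Beta_reflection[OF \<alpha>] G_def)
qed

section \<open>Weak convergence on the unit interval from moments\<close>

text \<open>If power series with uniformly bounded coefficients converge pointwise to \<open>0\<close> on \<open>(0, 1)\<close>,
  then so do their coefficients.  By induction the terms below \<open>n\<close> are negligible; after division
  by \<open>a\<^sup>n\<close> the terms above \<open>n\<close> contribute \<open>O(a)\<close>, which is small for a suitable fixed \<open>a\<close>.\<close>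

lemma power_series_coefficients_tendsto_0:
  fixes d :: "nat \<Rightarrow> 'i \<Rightarrow> real"
  assumes bound: "\<forall>\<^sub>F x in F. \<forall>k. \<bar>d k x\<bar> \<le> C"
    and lim: "\<And>a. 0 < a \<Longrightarrow> a < 1 \<Longrightarrow> ((\<lambda>x. \<Sum>k. d k x * a ^ k) \<longlongrightarrow> 0) F"
  shows "(d n \<longlongrightarrow> 0) F"
proof (induction n rule: less_induct)
  case (less n)
  show ?case
  proof (rule tendstoI)
    fix e :: real assume "e > 0"
    define a where "a = min (1 / 2) (e / (4 * (\<bar>C\<bar> + 1)))"
    have "a \<le> 1 / 2"
      unfolding a_def by (rule min.cobounded1)
    then have a: "0 < a" "a \<le> 1 / 2" "a < 1"
      using \<open>e > 0\<close> by (auto simp: a_def)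
    have "a * (4 * (\<bar>C\<bar> + 1)) \<le> e"
      using min.cobounded2[of "1 / 2" "e / (4 * (\<bar>C\<bar> + 1))"]
      unfolding a_def[symmetric] by (subst (asm) pos_le_divide_eq) auto
    then have aC: "2 * a * \<bar>C\<bar> < e / 2"
      using a by (simp add: algebra_simps)
    have "((\<lambda>x. ((\<Sum>k. d k x * a ^ k) - (\<Sum>k<n. d k x * a ^ k)) / a ^ n) \<longlongrightarrow>
             (0 - (\<Sum>k<n. 0 * a ^ k)) / a ^ n) F"
      using a by (intro tendsto_intros lim less) auto
    then have "((\<lambda>x. ((\<Sum>k. d k x * a ^ k) - (\<Sum>k<n. d k x * a ^ k)) / a ^ n) \<longlongrightarrow> 0) F"
      by simp
    from tendstoD[OF this half_gt_zero[OF \<open>e > 0\<close>]] bound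
    show "\<forall>\<^sub>F x in F. dist (d n x) 0 < e"
    proof eventually_elim
      case (elim x)
      have geo: "(\<lambda>k. \<bar>C\<bar> * a ^ (k + m)) sums (\<bar>C\<bar> * (a ^ m / (1 - a)))" for m
        using sums_mult[OF sums_mult2[OF geometric_sums[of a], of "a ^ m"], of "\<bar>C\<bar>"] a
        by (simp add: power_add)
      have term_le: "norm (d k x * a ^ j) \<le> \<bar>C\<bar> * a ^ j" for k j
        using elim(2)[rule_format, of k] a by (simp add: abs_mult mult_right_mono)
      have summable: "summable (\<lambda>k. d k x * a ^ k)"
        by (rule summable_comparison_test'[OF sums_summable[OF geo[of 0]], of 0]) (use term_le in simp)
      define R where "R = (\<Sum>k. d (k + Suc n) x * a ^ (k + Suc n))"
      have "norm R \<le> \<bar>C\<bar> * (a ^ Suc n / (1 - a))"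
        unfolding R_def sums_unique[OF geo[of "Suc n"]]
        by (intro norm_suminf_le term_le sums_summable[OF geo])
      also have "\<dots> \<le> \<bar>C\<bar> * (a ^ Suc n / (1 / 2))"
        using a by (intro mult_left_mono divide_left_mono) auto
      also have "\<dots> = a ^ n * (2 * a * \<bar>C\<bar>)"
        by simp
      finally have R: "\<bar>R\<bar> / a ^ n \<le> 2 * a * \<bar>C\<bar>"
        using a by (simp add: field_simps)
      have "(\<Sum>k. d k x * a ^ k) = R + (\<Sum>k<Suc n. d k x * a ^ k)"
        unfolding R_def by (rule suminf_split_initial_segment[OF summable])
      then have "d n x = ((\<Sum>k. d k x * a ^ k) - (\<Sum>k<n. d k x * a ^ k)) / a ^ n - R / a ^ n"
        using a by (simp add: field_simps)
      also have "\<bar>\<dots>\<bar> \<le> \<bar>((\<Sum>k. d k x * a ^ k) - (\<Sum>k<n. d k x * a ^ k)) / a ^ n\<bar> + \<bar>R\<bar> / a ^ n"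
        using a by (intro order.trans[OF abs_triangle_ineq4]) simp
      also have "\<dots> < e / 2 + e / 2"
        using elim(1) order.strict_trans1[OF R aC]
        by (intro add_strict_mono) (simp_all only: dist_real_def diff_zero)
      finally show ?case by simp
    qed
  qed
qed

definition unit_interval_measure :: "real measure \<Rightarrow> bool" where
  "unit_interval_measure K \<longleftrightarrow>
     finite_measure K \<and> sets K = sets borel \<and> (AE u in K. 0 \<le> u \<and> u \<le> 1)"

lemma unit_interval_measure_integrable:
  fixes f :: "real \<Rightarrow> real"
  assumes "unit_interval_measure K" "f \<in> borel_measurable borel"
    and "\<And>u. 0 \<le> u \<Longrightarrow> u \<le> 1 \<Longrightarrow> \<bar>f u\<bar> \<le> B"
  shows "integrable K f"
proof -
  interpret finite_measure K using assms(1) by (simp add: unit_interval_measure_def)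
  have "f \<in> borel_measurable K"
    using assms(1,2) by (simp add: unit_interval_measure_def cong: measurable_cong_sets)
  moreover have "AE u in K. 0 \<le> u \<and> u \<le> 1"
    using assms(1) by (simp add: unit_interval_measure_def)
  then have "AE u in K. norm (f u) \<le> B"
    by eventually_elim (simp add: assms(3))
  ultimately show ?thesis
    by (intro integrable_const_bound)
qed

lemma unit_interval_measure_integral_mono:
  fixes f g :: "real \<Rightarrow> real"
  assumes "unit_interval_measure K" "integrable K f" "integrable K g"
    and "\<And>u. 0 \<le> u \<Longrightarrow> u \<le> 1 \<Longrightarrow> f u \<le> g u"
  shows "(LINT u|K. f u) \<le> (LINT u|K. g u)"
proof (rule integral_mono_AE[OF assms(2,3)])
  have "AE u in K. 0 \<le> u \<and> u \<le> 1"
    using assms(1) by (simp add: unit_interval_measure_def)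
  then show "AE u in K. f u \<le> g u"
    by eventually_elim (simp add: assms(4))
qed

lemma unit_interval_measure_integral_dist_le:
  fixes f g :: "real \<Rightarrow> real"
  assumes "unit_interval_measure K" "integrable K f" "integrable K g"
    and "\<And>u. 0 \<le> u \<Longrightarrow> u \<le> 1 \<Longrightarrow> \<bar>f u - g u\<bar> \<le> e"
  shows "\<bar>(LINT u|K. f u) - (LINT u|K. g u)\<bar> \<le> e * measure K (space K)"
proof -
  interpret finite_measure K using assms(1) by (simp add: unit_interval_measure_def)
  have "\<bar>(LINT u|K. f u) - (LINT u|K. g u)\<bar> = \<bar>LINT u|K. f u - g u\<bar>"
    using assms by simp
  also have "\<dots> \<le> (LINT u|K. \<bar>f u - g u\<bar>)"
    by (rule integral_abs_bound)
  also have "\<dots> \<le> (LINT u|K. e)"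
    using assms by (intro unit_interval_measure_integral_mono) auto
  finally show ?thesis by (simp add: mult.commute)
qed

text \<open>Convergence of moments is convergence on polynomials.  It extends to continuous functions
  because polynomials are uniformly dense on \<open>[0, 1]\<close> and the total masses, being moments of
  order \<open>0\<close>, stay bounded.\<close>

lemma moments_imp_weak_convergence:
  fixes K :: "'i \<Rightarrow> real measure" and f :: "real \<Rightarrow> real"
  assumes K: "\<forall>\<^sub>F i in F. unit_interval_measure (K i)" and N: "unit_interval_measure N"
    and moments: "\<And>k. ((\<lambda>i. LINT u|K i. u ^ k) \<longlongrightarrow> (LINT u|N. u ^ k)) F"
    and f: "continuous_on UNIV f"
  shows "((\<lambda>i. LINT u|K i. f u) \<longlongrightarrow> (LINT u|N. f u)) F"
proof (rule tendstoI)
  fix e :: real assume "e > 0"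
  have f_meas: "f \<in> borel_measurable borel"
    using f by (rule borel_measurable_continuous_onI)
  have "bounded (f ` {0..1})"
    using f by (intro compact_imp_bounded compact_continuous_image continuous_on_subset[OF f]) auto
  then obtain B where "\<forall>u\<in>{0..1}. \<bar>f u\<bar> \<le> B"
    by (auto simp: bounded_iff)
  then have f_int: "integrable J f" if "unit_interval_measure J" for J
    using that by (intro unit_interval_measure_integrable[OF that f_meas, of B]) auto
  define m where "m = measure N (space N)"
  have m: "m \<ge> 0" by (simp add: m_def)
  define d where "d = e / (3 * (m + 1))"
  have d: "d > 0" "d * (m + 1) = e / 3" "d * m \<le> e / 3"
    using \<open>e > 0\<close> m by (auto simp: d_def field_simps)
  obtain g where g: "real_polynomial_function g" and fg: "\<And>u. u \<in> {0..1} \<Longrightarrow> \<bar>f u - g u\<bar> < d"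
    using Stone_Weierstrass_real_polynomial_function[OF compact_Icc continuous_on_subset[OF f] d(1), of 0 1]
    by auto
  obtain c n where g_eq: "g = (\<lambda>u. \<Sum>k\<le>n. c k * u ^ k)"
    using g unfolding real_polynomial_function_iff_sum by blast
  have pow_int: "integrable J (\<lambda>u. u ^ k)" if "unit_interval_measure J" for J and k :: nat
    by (intro unit_interval_measure_integrable[OF that, of _ 1]) (auto simp: power_le_one)
  have g_int: "integrable J g" if "unit_interval_measure J" for J
    unfolding g_eq using pow_int[OF that] by auto
  have g_val: "(LINT u|J. g u) = (\<Sum>k\<le>n. c k * (LINT u|J. u ^ k))" if "unit_interval_measure J" for J
    unfolding g_eq using pow_int[OF that] by simp
  have close: "\<bar>(LINT u|J. f u) - (LINT u|J. g u)\<bar> \<le> d * measure J (space J)"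
    if "unit_interval_measure J" for J
    using fg by (intro unit_interval_measure_integral_dist_le[OF that f_int g_int] that) (auto intro: less_imp_le)
  have "((\<lambda>i. \<Sum>k\<le>n. c k * (LINT u|K i. u ^ k)) \<longlongrightarrow> (\<Sum>k\<le>n. c k * (LINT u|N. u ^ k))) F"
    by (intro tendsto_intros moments)
  then have "\<forall>\<^sub>F i in F. dist (\<Sum>k\<le>n. c k * (LINT u|K i. u ^ k)) (\<Sum>k\<le>n. c k * (LINT u|N. u ^ k)) < e / 3"
    by (rule tendstoD) (use \<open>e > 0\<close> in simp)
  moreover have "\<forall>\<^sub>F i in F. (LINT u|K i. u ^ 0) < m + 1"
    using moments[of 0] by (rule order_tendstoD) (simp add: m_def)
  ultimately show "\<forall>\<^sub>F i in F. dist (LINT u|K i. f u) (LINT u|N. f u) < e"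
    using K
  proof eventually_elim
    case (elim i)
    have "d * measure (K i) (space (K i)) \<le> d * (m + 1)"
      using elim(2) d(1) by (intro mult_left_mono) auto
    then show ?case
      using close[OF elim(3)] close[OF N] elim(1) d g_val[OF elim(3)] g_val[OF N]
      unfolding m_def[symmetric] dist_real_def by linarith
  qed
qed

text \<open>The geometric series for \<open>1 / (1 - a u)\<close>, integrated term by term.\<close>

lemma moment_generating_sums:
  assumes K: "unit_interval_measure K" and a: "0 < a" "a < 1"
  shows "(\<lambda>k. (LINT u|K. u ^ k) * a ^ k) sums (LINT u|K. 1 / (1 - a * u))"
proof -
  interpret finite_measure K using K by (simp add: unit_interval_measure_def)
  have ae: "AE u in K. 0 \<le> u \<and> u \<le> 1"
    using K by (simp add: unit_interval_measure_def)
  have pow_le: "\<bar>(a * u) ^ k\<bar> \<le> a ^ k" if "0 \<le> u" "u \<le> 1" for u k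
  proof -
    have "a * u \<le> a" using that a mult_left_mono[of u 1 a] by simp
    then show ?thesis using that a by (simp add: power_mono)
  qed
  have pow_le_1: "\<bar>(a * u) ^ k\<bar> \<le> 1" if "0 \<le> u" "u \<le> 1" for u k
    using order.trans[OF pow_le[OF that]] a by (simp add: power_le_one)
  have int: "integrable K (\<lambda>u. (a * u) ^ k)" for k
    by (rule unit_interval_measure_integrable[OF K _ pow_le_1]) measurable
  have "(\<lambda>k. LINT u|K. (a * u) ^ k) sums (LINT u|K. (\<Sum>k. (a * u) ^ k))"
  proof (rule sums_integral[OF int])
    show "AE u in K. summable (\<lambda>k. norm ((a * u) ^ k))"
      using ae
    proof eventually_elim
      case (elim u)
      then have "a * u < 1" using mult_left_mono[of u 1 a] a by linarith
      then have "norm (a * u) < 1" using a elim by simp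
      then show ?case unfolding norm_power by (intro summable_geometric) simp
    qed
    have le: "norm (LINT u|K. norm ((a * u) ^ k)) \<le> a ^ k * measure K (space K)" for k
    proof -
      have "(LINT u|K. norm ((a * u) ^ k)) \<le> (LINT u|K. a ^ k)"
        using pow_le int by (intro unit_interval_measure_integral_mono[OF K]) auto
      then show ?thesis by (simp add: mult.commute)
    qed
    have "summable (\<lambda>k. a ^ k * measure K (space K))"
      using a by (intro summable_mult2 summable_geometric) auto
    then show "summable (\<lambda>k. LINT u|K. norm ((a * u) ^ k))"
      by (rule summable_comparison_test'[of _ 0]) (rule le)
  qed
  moreover have "(LINT u|K. (\<Sum>k. (a * u) ^ k)) = (LINT u|K. 1 / (1 - a * u))"
  proof (rule integral_cong_AE)
    show "AE u in K. (\<Sum>k. (a * u) ^ k) = 1 / (1 - a * u)"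
      using ae
    proof eventually_elim
      case (elim u)
      then have "a * u < 1" using mult_left_mono[of u 1 a] a by linarith
      then have "norm (a * u) < 1" using a elim by simp
      then show ?case by (rule suminf_geometric)
    qed
  qed (use K in \<open>auto simp: unit_interval_measure_def cong: measurable_cong_sets\<close>)
  ultimately show ?thesis
    by (simp add: power_mult_distrib mult.commute)
qed

text \<open>The coefficients of the generating function are the moments, so this combines the two
  preceding principles.  The moments are bounded uniformly because \<open>u\<^sup>k \<le> 1 \<le> 1 / (1 - u / 2)\<close>,
  whose integrals converge.\<close>

lemma generating_function_imp_weak_convergence:
  fixes K :: "'i \<Rightarrow> real measure" and f :: "real \<Rightarrow> real"
  assumes K: "\<forall>\<^sub>F i in F. unit_interval_measure (K i)" and N: "unit_interval_measure N"
    and lim: "\<And>a. 0 < a \<Longrightarrow> a < 1 \<Longrightarrow>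
      ((\<lambda>i. LINT u|K i. 1 / (1 - a * u)) \<longlongrightarrow> (LINT u|N. 1 / (1 - a * u))) F"
    and f: "continuous_on UNIV f"
  shows "((\<lambda>i. LINT u|K i. f u) \<longlongrightarrow> (LINT u|N. f u)) F"
proof (rule moments_imp_weak_convergence[OF K N _ f])
  fix k
  define C where "C = (LINT u|N. 1 / (1 - 1 / 2 * u)) + 1"
  have moment_bound: "\<bar>LINT u|J. u ^ k\<bar> \<le> (LINT u|J. 1 / (1 - 1 / 2 * u))"
    if J: "unit_interval_measure J" for J and k :: nat
  proof -
    have pow_int: "integrable J (\<lambda>u. u ^ k)"
      by (intro unit_interval_measure_integrable[OF J, of _ 1]) (auto simp: power_le_one)
    have inv_int: "integrable J (\<lambda>u. 1 / (1 - 1 / 2 * u))"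
      by (intro unit_interval_measure_integrable[OF J, of _ 2]) (auto simp: field_simps)
    have "\<bar>LINT u|J. u ^ k\<bar> \<le> (LINT u|J. \<bar>u ^ k\<bar>)"
      by (rule integral_abs_bound)
    also have "\<dots> \<le> (LINT u|J. 1 / (1 - 1 / 2 * u))"
    proof (rule unit_interval_measure_integral_mono[OF J])
      fix u :: real assume u: "0 \<le> u" "u \<le> 1"
      have "\<bar>u ^ k\<bar> \<le> 1" using u by (simp add: power_le_one)
      also have "1 \<le> 1 / (1 - 1 / 2 * u)" using u by (simp add: field_simps)
      finally show "\<bar>u ^ k\<bar> \<le> 1 / (1 - 1 / 2 * u)" .
    qed (use pow_int inv_int in auto)
    finally show ?thesis .
  qed
  have "((\<lambda>i. (LINT u|K i. u ^ k) - (LINT u|N. u ^ k)) \<longlongrightarrow> 0) F"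
  proof (rule power_series_coefficients_tendsto_0)
    have "\<forall>\<^sub>F i in F. (LINT u|K i. 1 / (1 - 1 / 2 * u)) < C"
      using lim[of "1 / 2"] by (intro order_tendstoD) (auto simp: C_def)
    with K show "\<forall>\<^sub>F i in F. \<forall>k. \<bar>(LINT u|K i. u ^ k) - (LINT u|N. u ^ k)\<bar> \<le> 2 * C"
    proof eventually_elim
      case (elim i)
      show ?case
      proof
        fix k
        show "\<bar>(LINT u|K i. u ^ k) - (LINT u|N. u ^ k)\<bar> \<le> 2 * C"
          using moment_bound[OF elim(1), of k] moment_bound[OF N, of k] elim(2) C_def by linarith
      qed
    qed
    fix a :: real assume a: "0 < a" "a < 1"
    have "((\<lambda>i. (LINT u|K i. 1 / (1 - a * u)) - (LINT u|N. 1 / (1 - a * u))) \<longlongrightarrow>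
        (LINT u|N. 1 / (1 - a * u)) - (LINT u|N. 1 / (1 - a * u))) F"
      by (intro tendsto_diff lim a tendsto_const)
    moreover have "\<forall>\<^sub>F i in F. (LINT u|K i. 1 / (1 - a * u)) - (LINT u|N. 1 / (1 - a * u)) =
        (\<Sum>k. ((LINT u|K i. u ^ k) - (LINT u|N. u ^ k)) * a ^ k)"
      using K
    proof eventually_elim
      case (elim i)
      show ?case
        using sums_diff[OF moment_generating_sums[OF elim a] moment_generating_sums[OF N a]]
        by (simp add: sums_iff left_diff_distrib)
    qed
    ultimately show "((\<lambda>i. \<Sum>k. ((LINT u|K i. u ^ k) - (LINT u|N. u ^ k)) * a ^ k) \<longlongrightarrow> 0) F"
      by (auto dest: Lim_transform_eventually)
  qed
  then show "((\<lambda>i. LINT u|K i. u ^ k) \<longlongrightarrow> (LINT u|N. u ^ k)) F"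
    by (simp add: LIM_zero_iff)
qed

section \<open>From the transform to the tail\<close>

text \<open>The scale-invariant limit on the half-line is \<open>\<alpha> v\<^sup>-\<^sup>\<alpha>\<^sup>-\<^sup>1 dv\<close>, whose tail is \<open>v\<^sup>-\<^sup>\<alpha>\<close>.  This
  measure is its image under \<open>u = 1 / (1 + v)\<close>, after multiplication by the density \<open>v / (1 + v) = 1 - u\<close>
  that makes it finite.\<close>

definition beta_measure :: "real \<Rightarrow> real measure" where
  "beta_measure \<alpha> =
     density lborel (\<lambda>u. ennreal (indicator {0..1} u * (\<alpha> * (u powr (\<alpha> - 1) * (1 - u) powr - \<alpha>))))"

lemma beta_density_integrable:
  fixes \<alpha> :: real
  assumes "0 < \<alpha>" "\<alpha> < 1"
  shows "integrable lborel (\<lambda>u. indicator {0..1} u * (\<alpha> * (u powr (\<alpha> - 1) * (1 - u) powr - \<alpha>)))"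
proof -
  have "integrable lborel (\<lambda>u. \<alpha> * (indicator {0..1} u * (u powr (\<alpha> - 1) * (1 - u) powr - \<alpha>)))"
    using integrable_Beta[of \<alpha> "1 - \<alpha>"] assms by (simp add: set_integrable_def)
  then show ?thesis
    by (simp add: mult_ac)
qed

lemma unit_interval_measure_beta:
  assumes "0 < \<alpha>" "\<alpha> < 1"
  shows "unit_interval_measure (beta_measure \<alpha>)"
  unfolding unit_interval_measure_def
proof (intro conjI)
  show "finite_measure (beta_measure \<alpha>)"
  proof (rule finite_measureI)
    have "emeasure (beta_measure \<alpha>) (space (beta_measure \<alpha>)) =
        (\<integral>\<^sup>+u. ennreal (indicator {0..1} u * (\<alpha> * (u powr (\<alpha> - 1) * (1 - u) powr - \<alpha>))) \<partial>lborel)"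
      by (simp add: beta_measure_def emeasure_density)
    also have "\<dots> < \<infinity>"
      using beta_density_integrable[OF assms] assms
      by (subst nn_integral_eq_integral) auto
    finally show "emeasure (beta_measure \<alpha>) (space (beta_measure \<alpha>)) \<noteq> \<infinity>"
      by simp
  qed
  show "AE u in beta_measure \<alpha>. 0 \<le> u \<and> u \<le> 1"
    unfolding beta_measure_def by (subst AE_density) (auto simp: indicator_def)
qed (simp add: beta_measure_def)

lemma integral_beta_measure:
  fixes f :: "real \<Rightarrow> real"
  assumes "0 < \<alpha>" "f \<in> borel_measurable borel"
  shows "(LINT u|beta_measure \<alpha>. f u) =
    (LINT u|lborel. indicator {0..1} u * (\<alpha> * (u powr (\<alpha> - 1) * (1 - u) powr - \<alpha>)) * f u)"
proof -
  note [measurable] = assms(2)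
  have "(LINT u|beta_measure \<alpha>. f u) =
    (LINT u|lborel. (indicator {0..1} u * (\<alpha> * (u powr (\<alpha> - 1) * (1 - u) powr - \<alpha>))) *\<^sub>R f u)"
    unfolding beta_measure_def
  proof (rule integral_density)
    show "AE u in lborel. 0 \<le> indicator {0..1} u * (\<alpha> * (u powr (\<alpha> - 1) * (1 - u) powr - \<alpha>))"
      using assms(1) by (intro AE_I2) simp
  qed measurable
  then show ?thesis by simp
qed

lemma beta_measure_moment:
  assumes "0 < \<alpha>" "\<alpha> < 1"
  shows "(LINT u|beta_measure \<alpha>. u ^ k) = pi * \<alpha> / sin (pi * \<alpha>) * ((-1) ^ k * ((- \<alpha>) gchoose k))"
proof -
  have "(LINT u|beta_measure \<alpha>. u ^ k) =
      (LINT u|lborel. \<alpha> * (indicator {0..1} u * (u powr (\<alpha> + real k - 1) * (1 - u) powr (1 - \<alpha> - 1))))"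
  proof (subst integral_beta_measure)
    have "u powr (\<alpha> - 1) * u ^ k = u powr (\<alpha> + real k - 1)" if "u \<ge> 0" for u :: real
    proof (cases "u = 0")
      case False
      then show ?thesis
        using that by (simp add: powr_realpow[symmetric] powr_add[symmetric] add.commute add_diff_eq)
    qed simp
    then show "(LINT u|lborel. indicator {0..1} u * (\<alpha> * (u powr (\<alpha> - 1) * (1 - u) powr - \<alpha>)) * u ^ k) =
      (LINT u|lborel. \<alpha> * (indicator {0..1} u * (u powr (\<alpha> + real k - 1) * (1 - u) powr (1 - \<alpha> - 1))))"
      by (intro Bochner_Integration.integral_cong) (auto simp: indicator_def mult_ac)
  qed (use assms in auto)
  also have "\<dots> = \<alpha> * Beta (\<alpha> + real k) (1 - \<alpha>)"
    using set_borel_integral_eq_integral(2)[OF integrable_Beta, of "\<alpha> + real k" "1 - \<alpha>"]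
      integral_unique[OF has_integral_Beta_real, of "\<alpha> + real k" "1 - \<alpha>"] assms
    by (simp add: set_lebesgue_integral_def)
  finally show ?thesis
    by (simp add: Beta_moment[OF assms])
qed

lemma beta_measure_generating_function:
  assumes "0 < \<alpha>" "\<alpha> < 1" "0 < a" "a < 1"
  shows "(LINT u|beta_measure \<alpha>. 1 / (1 - a * u)) = pi * \<alpha> / sin (pi * \<alpha>) * (1 - a) powr - \<alpha>"
proof (rule sums_unique2)
  show "(\<lambda>k. (LINT u|beta_measure \<alpha>. u ^ k) * a ^ k) sums (LINT u|beta_measure \<alpha>. 1 / (1 - a * u))"
    by (intro moment_generating_sums unit_interval_measure_beta assms)
  have "(\<lambda>k. pi * \<alpha> / sin (pi * \<alpha>) * (((- \<alpha>) gchoose k) * (- a) ^ k)) sums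
      (pi * \<alpha> / sin (pi * \<alpha>) * (1 + - a) powr - \<alpha>)"
    using assms by (intro sums_mult gen_binomial_real) auto
  moreover have "(- a) ^ k = (-1) ^ k * a ^ k" for k
    by (rule power_minus)
  ultimately show "(\<lambda>k. (LINT u|beta_measure \<alpha>. u ^ k) * a ^ k) sums
      (pi * \<alpha> / sin (pi * \<alpha>) * (1 - a) powr - \<alpha>)"
    by (simp add: beta_measure_moment assms mult_ac)
qed

text \<open>Removing the density \<open>1 - u\<close> recovers the tail of \<open>\<alpha> v\<^sup>-\<^sup>\<alpha>\<^sup>-\<^sup>1 dv\<close> at \<open>v = (1 - \<theta>) / \<theta>\<close>; an
  antiderivative in \<open>u\<close> is \<open>(u / (1 - u))\<^sup>\<alpha>\<close>.\<close>

lemma beta_measure_tail: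
  assumes \<alpha>: "0 < \<alpha>" "\<alpha> < 1" and \<theta>: "0 < \<theta>" "\<theta> < 1"
  shows "(LINT u|beta_measure \<alpha>. indicator {..\<theta>} u / (1 - u)) = (\<theta> / (1 - \<theta>)) powr \<alpha>"
proof -
  define g where "g = (\<lambda>u::real. \<alpha> * u powr (\<alpha> - 1) * (1 - u) powr (- \<alpha> - 1))"
  define H where "H = (\<lambda>u::real. (u / (1 - u)) powr \<alpha>)"
  have "(g has_integral (H \<theta> - H 0)) {0..\<theta>}"
  proof (rule fundamental_theorem_of_calculus_interior)
    show "continuous_on {0..\<theta>} H"
      unfolding H_def
    proof (rule continuous_on_powr')
      show "continuous_on {0..\<theta>} (\<lambda>u. u / (1 - u))"
        using \<theta> by (intro continuous_intros) auto
    qed (use \<alpha> \<theta> in auto)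
    fix u assume u: "u \<in> {0<..<\<theta>}"
    have "((\<lambda>u. (u / (1 - u)) powr \<alpha>) has_real_derivative
        \<alpha> * (u / (1 - u)) powr (\<alpha> - 1) * ((1 * (1 - u) - u * (0 - 1)) / ((1 - u) * (1 - u)))) (at u)"
      using u \<theta> by (auto intro!: derivative_eq_intros)
    also have "\<alpha> * (u / (1 - u)) powr (\<alpha> - 1) * ((1 * (1 - u) - u * (0 - 1)) / ((1 - u) * (1 - u))) = g u"
    proof -
      have "(1 - u) powr (\<alpha> - 1) * ((1 - u) * (1 - u)) = (1 - u) powr (\<alpha> + 1)"
        using u \<theta> powr_add[of "1 - u" "\<alpha> - 1" 2] by (simp add: powr_numeral power2_eq_square add.commute)
      moreover have "(1 - u) powr (- \<alpha> - 1) = 1 / (1 - u) powr (\<alpha> + 1)"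
        using powr_minus_divide[of "1 - u" "\<alpha> + 1"] by simp
      ultimately have "(u / (1 - u)) powr (\<alpha> - 1) / ((1 - u) * (1 - u)) =
          u powr (\<alpha> - 1) * (1 - u) powr (- \<alpha> - 1)"
        using u \<theta> by (simp add: powr_divide)
      from arg_cong[OF this, of "\<lambda>z. \<alpha> * z"] show ?thesis
        by (simp add: g_def mult.assoc)
    qed
    finally show "(H has_vector_derivative g u) (at u)"
      by (simp add: H_def has_real_derivative_iff_has_vector_derivative)
  qed (use \<theta> in auto)
  then have hi: "(g has_integral (\<theta> / (1 - \<theta>)) powr \<alpha>) {0..\<theta>}"
    using \<alpha> by (simp add: H_def)
  have g_meas: "(\<lambda>u. indicator {0..\<theta>} u * g u) \<in> borel_measurable lborel"
    unfolding g_def by measurable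
  have "(LINT u|beta_measure \<alpha>. indicator {..\<theta>} u / (1 - u)) =
      (LINT u|lborel. indicator {0..\<theta>} u * g u)"
  proof (subst integral_beta_measure)
    show "(LINT u|lborel. indicator {0..1} u * (\<alpha> * (u powr (\<alpha> - 1) * (1 - u) powr - \<alpha>)) *
        (indicator {..\<theta>} u / (1 - u))) = (LINT u|lborel. indicator {0..\<theta>} u * g u)"
    proof (intro Bochner_Integration.integral_cong refl)
      fix u :: real
      have "(1 - u) powr (- \<alpha> - 1) = (1 - u) powr - \<alpha> / (1 - u)" if "u \<le> \<theta>"
        using that \<theta> by (simp add: powr_diff)
      then show "indicator {0..1} u * (\<alpha> * (u powr (\<alpha> - 1) * (1 - u) powr - \<alpha>)) *
        (indicator {..\<theta>} u / (1 - u)) = indicator {0..\<theta>} u * g u"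
        using \<theta> by (auto simp: g_def indicator_def)
    qed
  qed (use \<alpha> in auto)
  also have "\<dots> = (\<theta> / (1 - \<theta>)) powr \<alpha>"
  proof -
    have "(\<integral>\<^sup>+u. ennreal (indicator {0..\<theta>} u * g u) \<partial>lborel) = ennreal ((\<theta> / (1 - \<theta>)) powr \<alpha>)"
      using nn_integral_has_integral_lebesgue[OF _ hi] \<alpha> by (simp add: g_def)
    then show ?thesis
      using g_meas \<alpha> by (simp add: integral_eq_nn_integral g_def)
  qed
  finally show ?thesis .
qed

text \<open>The substitution \<open>u = x / (x + t)\<close> puts all scales \<open>x\<close> on the same compact interval.  The weight
  \<open>t / (x + t) = 1 - u\<close> matches that of \<open>beta_measure\<close> and makes the total mass \<open>stieltjes \<mu> x / r\<close>.\<close>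

definition scaled_measure :: "real measure \<Rightarrow> real \<Rightarrow> real \<Rightarrow> real measure" where
  "scaled_measure \<mu> r x = distr (density \<mu> (\<lambda>t. ennreal (t / (x + t) / r))) borel (\<lambda>t. x / (x + t))"

lemma integral_scaled_measure:
  fixes f :: "real \<Rightarrow> real"
  assumes "\<mu> \<in> M_plus" "0 < x" "0 < r" "f \<in> borel_measurable borel"
  shows "(LINT u|scaled_measure \<mu> r x. f u) = (LINT t|\<mu>. f (x / (x + t)) * (t / (x + t))) / r"
proof -
  have [measurable]: "(\<lambda>t. x / (x + t)) \<in> borel_measurable \<mu>" "(\<lambda>t. t / (x + t) / r) \<in> borel_measurable \<mu>"
    by (auto intro!: M_plus_measurable[OF assms(1)])
  note [measurable] = assms(4)
  have "(LINT u|scaled_measure \<mu> r x. f u) = (LINT t|\<mu>. t / (x + t) / r * f (x / (x + t)))"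
    unfolding scaled_measure_def
  proof (subst integral_distr)
    have "AE t in \<mu>. 0 \<le> t / (x + t) / r"
      using assms(2,3) M_plusD(3)[OF assms(1)] by (intro AE_I2) auto
    then show "(LINT t|density \<mu> (\<lambda>t. ennreal (t / (x + t) / r)). f (x / (x + t))) =
        (LINT t|\<mu>. t / (x + t) / r * f (x / (x + t)))"
      by (subst integral_density) (simp_all del: divide_divide_eq_left)
  qed simp_all
  also have "\<dots> = (LINT t|\<mu>. f (x / (x + t)) * (t / (x + t)) / r)"
    by (simp add: mult.commute)
  finally show ?thesis by (simp only: integral_divide_zero)
qed

lemma unit_interval_measure_scaled:
  assumes "\<mu> \<in> M_plus" "0 < x" "0 < r"
  shows "unit_interval_measure (scaled_measure \<mu> r x)"
  unfolding unit_interval_measure_def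
proof (intro conjI)
  have [measurable]: "(\<lambda>t. x / (x + t)) \<in> borel_measurable \<mu>" "(\<lambda>t. t / (x + t) / r) \<in> borel_measurable \<mu>"
    by (auto intro!: M_plus_measurable[OF assms(1)])
  show "finite_measure (scaled_measure \<mu> r x)"
    unfolding scaled_measure_def
  proof (rule finite_measure.finite_measure_distr)
    show "finite_measure (density \<mu> (\<lambda>t. ennreal (t / (x + t) / r)))"
    proof (rule finite_measureI)
      have "integrable \<mu> (\<lambda>t. t / (x + t) / r)"
        using stieltjes_integrable[OF assms(1,2)] by (rule integrable_divide_zero)
      then have "(\<integral>\<^sup>+t. ennreal (t / (x + t) / r) \<partial>\<mu>) < \<infinity>"
        using assms M_plusD(3)[OF assms(1)] by (subst nn_integral_eq_integral) auto
      then show "emeasure (density \<mu> (\<lambda>t. ennreal (t / (x + t) / r)))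
          (space (density \<mu> (\<lambda>t. ennreal (t / (x + t) / r)))) \<noteq> \<infinity>"
        by (simp add: emeasure_density del: divide_divide_eq_left)
    qed
  qed simp
  show "AE u in scaled_measure \<mu> r x. 0 \<le> u \<and> u \<le> 1"
    unfolding scaled_measure_def using assms(2) M_plusD(3)[OF assms(1)]
    by (subst AE_distr_iff) (auto simp: AE_density)
qed (simp add: scaled_measure_def)

text \<open>Karamata's method: the asymptotics of the transform at the scales \<open>(1 - a) x\<close> identify the weak
  limit of the rescaled measures as \<open>beta_measure \<alpha>\<close>.  The tail is the integral of
  \<open>u \<mapsto> 1 / (1 - u)\<close> cut off at \<open>u = 1/2\<close>.  The continuous functions \<open>f p q\<close> below replace the jump by a linear
  ramp \<open>r p q\<close> descending from \<open>p\<close> to \<open>q\<close>; \<open>(p, 1/2)\<close> with \<open>p \<rightarrow> 1/2\<close> gives a lower and \<open>(1/2, q)\<close> with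
  \<open>q \<rightarrow> 1/2\<close> an upper estimate.\<close>

theorem stieltjes_tauberian:
  assumes \<mu>: "\<mu> \<in> M_plus" and \<alpha>: "0 < \<alpha>" "\<alpha> < 1"
    and pos: "\<forall>\<^sub>F x in at_top. l x > 0"
    and rv: "\<And>c. c > 0 \<Longrightarrow> ((\<lambda>x. l (c * x) / l x) \<longlongrightarrow> c powr - \<alpha>) at_top"
    and lim: "((\<lambda>x. stieltjes \<mu> x / l x) \<longlongrightarrow> pi * \<alpha> / sin (pi * \<alpha>)) at_top"
  shows "((\<lambda>x. measure \<mu> {x<..} / l x) \<longlongrightarrow> 1) at_top"
proof -
  define K where "K = (\<lambda>x. scaled_measure \<mu> (l x) x)"
  define N where "N = beta_measure \<alpha>"
  interpret prob_space \<mu> using M_plusD(1)[OF \<mu>] .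
  have ev: "\<forall>\<^sub>F x in at_top. x > 0 \<and> l x > 0"
    by (intro eventually_conj eventually_gt_at_top pos)
  then have K: "\<forall>\<^sub>F x in at_top. unit_interval_measure (K x)"
    by eventually_elim (use unit_interval_measure_scaled[OF \<mu>] in \<open>simp add: K_def\<close>)
  have N: "unit_interval_measure N"
    unfolding N_def by (rule unit_interval_measure_beta[OF \<alpha>])
  have weak: "((\<lambda>x. LINT u|K x. f u) \<longlongrightarrow> (LINT u|N. f u)) at_top" if f: "continuous_on UNIV f"
    for f :: "real \<Rightarrow> real"
  proof (rule generating_function_imp_weak_convergence[OF K N])
    fix a :: real assume a: "0 < a" "a < 1"
    then have scale: "filterlim (\<lambda>x. (1 - a) * x) at_top at_top"
      by (intro filterlim_tendsto_pos_mult_at_top[OF tendsto_const _ filterlim_ident]) auto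
    have "((\<lambda>x. stieltjes \<mu> ((1 - a) * x) / l ((1 - a) * x) * (l ((1 - a) * x) / l x)) \<longlongrightarrow>
        pi * \<alpha> / sin (pi * \<alpha>) * (1 - a) powr - \<alpha>) at_top"
      using a by (intro tendsto_mult rv filterlim_compose[OF lim scale]) auto
    moreover have "\<forall>\<^sub>F x in at_top. stieltjes \<mu> ((1 - a) * x) / l ((1 - a) * x) * (l ((1 - a) * x) / l x) =
        (LINT u|K x. 1 / (1 - a * u))"
    proof -
      have "\<forall>\<^sub>F x in at_top. l ((1 - a) * x) > 0"
        using pos scale by (rule eventually_compose_filterlim)
      with ev show ?thesis
      proof eventually_elim
        case (elim x)
        have "1 / (1 - a * (x / (x + t))) * (t / (x + t)) = t / ((1 - a) * x + t)" if "t \<in> space \<mu>" for t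
        proof -
          have "x + t > 0" "(1 - a) * x + t > 0"
            using that elim a M_plusD(3)[OF \<mu>] by (auto intro!: add_pos_nonneg)
          moreover from this have "1 - a * (x / (x + t)) = ((1 - a) * x + t) / (x + t)"
            by (simp add: field_simps)
          ultimately show ?thesis by simp
        qed
        then have "(LINT t|\<mu>. 1 / (1 - a * (x / (x + t))) * (t / (x + t))) = stieltjes \<mu> ((1 - a) * x)"
          unfolding stieltjes_def by (rule Bochner_Integration.integral_cong[OF refl])
        moreover have "(LINT u|K x. 1 / (1 - a * u)) =
            (LINT t|\<mu>. 1 / (1 - a * (x / (x + t))) * (t / (x + t))) / l x"
          unfolding K_def using elim by (intro integral_scaled_measure[OF \<mu>]) auto
        ultimately have "(LINT u|K x. 1 / (1 - a * u)) = stieltjes \<mu> ((1 - a) * x) / l x"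
          by simp
        then show ?case
          using elim by simp
      qed
    qed
    ultimately show "((\<lambda>x. LINT u|K x. 1 / (1 - a * u)) \<longlongrightarrow> (LINT u|N. 1 / (1 - a * u))) at_top"
      unfolding N_def beta_measure_generating_function[OF \<alpha> a] by (rule Lim_transform_eventually)
  qed (rule f)
  define r where "r = (\<lambda>p q u::real. max 0 (min 1 ((q - u) / (q - p))))"
  \<comment> \<open>The maximum keeps the denominator away from \<open>0\<close>; it differs from \<open>1 - u\<close> only where the ramp vanishes.\<close>
  define f where "f = (\<lambda>p q u. r p q u / max (1 - u) (1 - q))"
  have r_eq: "r p q u = (if u \<le> p then 1 else if u \<ge> q then 0 else (q - u) / (q - p))" if "p < q" for p q u
    using that by (auto simp: r_def min_def max_def field_simps)
  have r_range: "0 \<le> r p q u" "r p q u \<le> 1" for p q u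
    by (auto simp: r_def)
  have f_eq: "f p q u * (1 - u) = r p q u" if "p < q" "q < 1" for p q u
    using that r_eq[OF that(1), of u] by (auto simp: f_def max_def)
  have f_cont: "continuous_on UNIV (f p q)" if "p < q" "q < 1" for p q
    unfolding f_def r_def using that by (intro continuous_intros) (auto simp: max_def)
  have f_meas: "f p q \<in> borel_measurable borel" if "p < q" "q < 1" for p q
    by (rule borel_measurable_continuous_onI[OF f_cont[OF that]])
  have f_int: "integrable N (f p q)" if "p < q" "q < 1" for p q
  proof (rule unit_interval_measure_integrable[OF N f_meas[OF that], of "1 / (1 - q)"])
    fix u :: real
    have "\<bar>f p q u\<bar> = r p q u / max (1 - u) (1 - q)"
      using r_range[of p q u] that by (simp add: f_def)
    also have "\<dots> \<le> 1 / (1 - q)"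
      using r_range[of p q u] that by (intro frac_le) auto
    finally show "\<bar>f p q u\<bar> \<le> 1 / (1 - q)" .
  qed
  have ind_int: "integrable N (\<lambda>u. indicator {..p} u / (1 - u))" if "p < 1" for p
    by (rule unit_interval_measure_integrable[OF N, of _ "1 / (1 - p)"])
      (use that in \<open>auto simp: indicator_def frac_le\<close>)
  have lower: "(p / (1 - p)) powr \<alpha> \<le> (LINT u|N. f p q u)" if "0 < p" "p < q" "q < 1" for p q
  proof -
    have "(p / (1 - p)) powr \<alpha> = (LINT u|N. indicator {..p} u / (1 - u))"
      unfolding N_def using that by (intro beta_measure_tail[symmetric] \<alpha>) auto
    also have "\<dots> \<le> (LINT u|N. f p q u)"
    proof (rule unit_interval_measure_integral_mono[OF N ind_int f_int])
      fix u :: real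
      show "indicator {..p} u / (1 - u) \<le> f p q u"
        using that r_range[of p q u] r_eq[of p q u] by (auto simp: indicator_def f_def max_def)
    qed (use that in auto)
    finally show ?thesis .
  qed
  have upper: "(LINT u|N. f p q u) \<le> (q / (1 - q)) powr \<alpha>" if "0 < p" "p < q" "q < 1" for p q
  proof -
    have "(LINT u|N. f p q u) \<le> (LINT u|N. indicator {..q} u / (1 - u))"
    proof (rule unit_interval_measure_integral_mono[OF N f_int ind_int])
      fix u :: real
      show "f p q u \<le> indicator {..q} u / (1 - u)"
        using that r_range[of p q u] r_eq[of p q u] by (auto simp: indicator_def f_def max_def divide_right_mono)
    qed (use that in auto)
    also have "\<dots> = (q / (1 - q)) powr \<alpha>"
      unfolding N_def using that by (intro beta_measure_tail \<alpha>) auto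
    finally show ?thesis .
  qed
  have K_val: "(LINT u|K x. f p q u) = (LINT t|\<mu>. r p q (x / (x + t))) / l x"
    if "p < q" "q < 1" "x > 0" "l x > 0" for p q x
  proof -
    have "f p q (x / (x + t)) * (t / (x + t)) = r p q (x / (x + t))" if "t \<in> space \<mu>" for t
    proof -
      have "t / (x + t) = 1 - x / (x + t)"
        using that \<open>x > 0\<close> M_plusD(3)[OF \<mu>] by (simp add: field_simps)
      then show ?thesis
        using f_eq[OF \<open>p < q\<close> \<open>q < 1\<close>] by simp
    qed
    then have "(LINT t|\<mu>. f p q (x / (x + t)) * (t / (x + t))) = (LINT t|\<mu>. r p q (x / (x + t)))"
      by (rule Bochner_Integration.integral_cong[OF refl])
    moreover have "(LINT u|K x. f p q u) = (LINT t|\<mu>. f p q (x / (x + t)) * (t / (x + t))) / l x"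
      unfolding K_def using that by (intro integral_scaled_measure[OF \<mu>] f_meas)
    ultimately show ?thesis
      by simp
  qed
  have r_int: "integrable \<mu> (\<lambda>t. r p q (x / (x + t)))" for p q x
    unfolding r_def by (rule M_plus_bounded_integrable[OF \<mu>, of _ 1]) auto
  have tail_val: "measure \<mu> {x<..} = (LINT t|\<mu>. indicator {x<..} t)" if "x > 0" for x
    using tail_sets[OF \<mu>, of x] that by simp
  have tail_int: "integrable \<mu> (indicator {x<..} :: real \<Rightarrow> real)" if "x > 0" for x
    using tail_sets[OF \<mu>, of x] that by (simp add: emeasure_eq_measure)
  have half: "x / (x + t) < 1 / 2 \<longleftrightarrow> x < t" if "x > 0" "t \<in> space \<mu>" for x t
    using that M_plusD(3)[OF \<mu>] by (simp add: field_simps)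
  show ?thesis
  proof (rule order_tendstoI)
    fix b :: real assume "b < 1"
    have "((\<lambda>p::real. (p / (1 - p)) powr \<alpha>) \<longlongrightarrow> (1 / 2 / (1 - 1 / 2)) powr \<alpha>) (at_left (1 / 2))"
      by (intro tendsto_intros) auto
    then have "\<forall>\<^sub>F p::real in at_left (1 / 2). b < (p / (1 - p)) powr \<alpha>"
      using \<open>b < 1\<close> by (intro order_tendstoD) auto
    moreover have "\<forall>\<^sub>F p::real in at_left (1 / 2). p \<in> {0<..<1 / 2}"
      by (rule eventually_at_left_real) simp
    ultimately have "\<forall>\<^sub>F p::real in at_left (1 / 2). b < (p / (1 - p)) powr \<alpha> \<and> 0 < p \<and> p < 1 / 2"
      by eventually_elim auto
    then obtain p :: real where p: "b < (p / (1 - p)) powr \<alpha>" "0 < p" "p < 1 / 2"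
      using eventually_happens trivial_limit_at_left_real by blast
    have "b < (LINT u|N. f p (1 / 2) u)"
      using lower[of p "1 / 2"] p by simp
    then have "\<forall>\<^sub>F x in at_top. b < (LINT u|K x. f p (1 / 2) u)"
      using p by (intro order_tendstoD(1)[OF weak] f_cont) auto
    with ev show "\<forall>\<^sub>F x in at_top. b < measure \<mu> {x<..} / l x"
    proof eventually_elim
      case (elim x)
      have "(LINT t|\<mu>. r p (1 / 2) (x / (x + t))) \<le> (LINT t|\<mu>. indicator {x<..} t)"
      proof (rule integral_mono[OF r_int tail_int])
        fix t assume t: "t \<in> space \<mu>"
        show "r p (1 / 2) (x / (x + t)) \<le> indicator {x<..} t"
        proof (cases "x < t")
          case True
          then show ?thesis using r_range by simp
        next
          case False
          then have "1 / 2 \<le> x / (x + t)" using half[of x t] elim t by linarith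
          moreover have "p < x / (x + t)" using calculation p by linarith
          ultimately have "r p (1 / 2) (x / (x + t)) = 0"
            using r_eq[OF p(3), of "x / (x + t)"] by simp
          then show ?thesis by simp
        qed
      qed (use elim in auto)
      then have "(LINT t|\<mu>. r p (1 / 2) (x / (x + t))) / l x \<le> measure \<mu> {x<..} / l x"
        using elim by (simp add: tail_val divide_right_mono)
      then show ?case
        using elim K_val[of p "1 / 2" x] p by simp
    qed
  next
    fix b :: real assume "b > 1"
    have "((\<lambda>q::real. (q / (1 - q)) powr \<alpha>) \<longlongrightarrow> (1 / 2 / (1 - 1 / 2)) powr \<alpha>) (at_right (1 / 2))"
      by (intro tendsto_intros) auto
    then have "\<forall>\<^sub>F q::real in at_right (1 / 2). b > (q / (1 - q)) powr \<alpha>"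
      using \<open>b > 1\<close> by (intro order_tendstoD) auto
    moreover have "\<forall>\<^sub>F q::real in at_right (1 / 2). q \<in> {1 / 2<..<1}"
      by (rule eventually_at_right_real) simp
    ultimately have "\<forall>\<^sub>F q::real in at_right (1 / 2). b > (q / (1 - q)) powr \<alpha> \<and> 1 / 2 < q \<and> q < 1"
      by eventually_elim auto
    then obtain q :: real where q: "b > (q / (1 - q)) powr \<alpha>" "1 / 2 < q" "q < 1"
      using eventually_happens trivial_limit_at_right_real by blast
    have "(LINT u|N. f (1 / 2) q u) < b"
      using upper[of "1 / 2" q] q by simp
    then have "\<forall>\<^sub>F x in at_top. (LINT u|K x. f (1 / 2) q u) < b"
      using q by (intro order_tendstoD(2)[OF weak] f_cont) auto
    with ev show "\<forall>\<^sub>F x in at_top. measure \<mu> {x<..} / l x < b"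
    proof eventually_elim
      case (elim x)
      have "(LINT t|\<mu>. indicator {x<..} t) \<le> (LINT t|\<mu>. r (1 / 2) q (x / (x + t)))"
      proof (rule integral_mono[OF tail_int r_int])
        fix t assume t: "t \<in> space \<mu>"
        show "indicator {x<..} t \<le> r (1 / 2) q (x / (x + t))"
        proof (cases "x < t")
          case True
          then have "x / (x + t) \<le> 1 / 2" using half[of x t] elim t by linarith
          then have "r (1 / 2) q (x / (x + t)) = 1"
            using r_eq[OF q(2), of "x / (x + t)"] by simp
          then show ?thesis using True by simp
        next
          case False
          then show ?thesis using r_range by simp
        qed
      qed (use elim in auto)
      then have "measure \<mu> {x<..} / l x \<le> (LINT t|\<mu>. r (1 / 2) q (x / (x + t))) / l x"
        using elim by (simp add: tail_val divide_right_mono)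
      then show ?case
        using elim K_val[of "1 / 2" q x] q by simp
    qed
  qed
qed

section \<open>The equivalence\<close>

lemma asymp_equiv_iff_quotient:
  fixes f g :: "real \<Rightarrow> real"
  assumes "\<forall>\<^sub>F x in F. g x \<noteq> 0"
  shows "f \<sim>[F] g \<longleftrightarrow> ((\<lambda>x. f x / g x) \<longlongrightarrow> 1) F"
proof -
  have "\<forall>\<^sub>F x in F. f x \<noteq> 0 \<or> g x \<noteq> 0"
    using assms by eventually_elim simp
  then show ?thesis
    using asymp_equivI' asymp_equivD_strong by blast
qed

lemma tendsto_powr_iff:
  fixes p :: "real \<Rightarrow> real"
  assumes "\<forall>\<^sub>F x in F. p x > 0" "c > 0" "s \<noteq> 0"
  shows "((\<lambda>x. p x powr s) \<longlongrightarrow> c powr s) F \<longleftrightarrow> (p \<longlongrightarrow> c) F"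
proof
  assume "((\<lambda>x. p x powr s) \<longlongrightarrow> c powr s) F"
  from tendsto_powr[OF this tendsto_const, of "1 / s"] assms(2)
  have "((\<lambda>x. (p x powr s) powr (1 / s)) \<longlongrightarrow> (c powr s) powr (1 / s)) F"
    by simp
  moreover have "\<forall>\<^sub>F x in F. (p x powr s) powr (1 / s) = p x"
    using assms(1) by eventually_elim (use assms in \<open>simp add: powr_powr\<close>)
  ultimately have "(p \<longlongrightarrow> (c powr s) powr (1 / s)) F"
    by (rule Lim_transform_eventually)
  then show "(p \<longlongrightarrow> c) F"
    using assms by (simp add: powr_powr)
next
  assume "(p \<longlongrightarrow> c) F"
  then show "((\<lambda>x. p x powr s) \<longlongrightarrow> c powr s) F"
    using assms by (intro tendsto_powr tendsto_const) auto
qed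

lemma filterlim_powr_at_top:
  assumes "0 < a"
  shows "filterlim (\<lambda>x::real. x powr a) at_top at_top"
proof -
  have "filterlim (\<lambda>x::real. exp (a * ln x)) at_top at_top"
    using assms
    by (intro filterlim_compose[OF exp_at_top] filterlim_tendsto_pos_mult_at_top[OF tendsto_const _ ln_at_top])
  moreover have "\<forall>\<^sub>F x::real in at_top. x powr a = exp (a * ln x)"
    using eventually_gt_at_top[of 0] by eventually_elim (simp add: powr_def)
  ultimately show ?thesis
    by (subst filterlim_cong[OF refl refl])
qed

lemma slowly_varying_eventually_pos:
  "slowly_varying L \<Longrightarrow> \<forall>\<^sub>F x in at_top. L x > 0"
  unfolding slowly_varying_def eventually_at_top_linorder by blast

lemma regularly_varying_quotient:
  assumes "slowly_varying L" "c > 0"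
  shows "((\<lambda>x. (c * x) powr s * L (c * x) / (x powr s * L x)) \<longlongrightarrow> c powr s) at_top"
proof -
  have "((\<lambda>x. c powr s * (L (c * x) / L x)) \<longlongrightarrow> c powr s * 1) at_top"
    using assms unfolding slowly_varying_def by (intro tendsto_mult tendsto_const) blast
  moreover have "\<forall>\<^sub>F x in at_top. c powr s * (L (c * x) / L x) =
      (c * x) powr s * L (c * x) / (x powr s * L x)"
    using eventually_gt_at_top[of 0] by eventually_elim (use assms(2) in \<open>simp add: powr_mult\<close>)
  ultimately show ?thesis
    by (auto dest: Lim_transform_eventually)
qed

text \<open>The Abelian direction needs regular variation of the tail itself and its positivity everywhere;
  both are inherited from the comparison function, the latter through monotonicity.\<close>

theorem tail_iff_stieltjes:
  assumes \<mu>: "\<mu> \<in> M_plus" and \<alpha>: "0 < \<alpha>" "\<alpha> < 1" and L: "slowly_varying L"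
  shows "((\<lambda>x. measure \<mu> {x<..} / (x powr - \<alpha> * L x)) \<longlongrightarrow> 1) at_top \<longleftrightarrow>
    ((\<lambda>x. stieltjes \<mu> x / (x powr - \<alpha> * L x)) \<longlongrightarrow> pi * \<alpha> / sin (pi * \<alpha>)) at_top"
proof -
  define l where "l = (\<lambda>x. x powr - \<alpha> * L x)"
  have l_pos: "\<forall>\<^sub>F x in at_top. l x > 0"
    using slowly_varying_eventually_pos[OF L] eventually_gt_at_top[of 0]
    by eventually_elim (simp add: l_def)
  have l_rv: "((\<lambda>x. l (c * x) / l x) \<longlongrightarrow> c powr - \<alpha>) at_top" if "c > 0" for c
    unfolding l_def by (rule regularly_varying_quotient[OF L that])
  have l_eq: "x powr - \<alpha> * L x = l x" for x
    by (simp add: l_def)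
  show ?thesis
    unfolding l_eq
  proof
    assume lim: "((\<lambda>x. stieltjes \<mu> x / l x) \<longlongrightarrow> pi * \<alpha> / sin (pi * \<alpha>)) at_top"
    show "((\<lambda>x. measure \<mu> {x<..} / l x) \<longlongrightarrow> 1) at_top"
      by (rule stieltjes_tauberian[OF \<mu> \<alpha> l_pos l_rv lim])
  next
    assume lim: "((\<lambda>x. measure \<mu> {x<..} / l x) \<longlongrightarrow> 1) at_top"
    have "\<forall>\<^sub>F x in at_top. 0 < measure \<mu> {x<..} / l x"
      by (rule order_tendstoD(1)[OF lim]) simp
    with l_pos have ev: "\<forall>\<^sub>F x in at_top. measure \<mu> {x<..} > 0 \<and> l x > 0"
      by eventually_elim (simp add: zero_less_divide_iff)
    have pos: "measure \<mu> {x<..} > 0" if x: "x > 0" for x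
    proof -
      have "\<forall>\<^sub>F y in at_top. measure \<mu> {y<..} > 0 \<and> y \<ge> x"
        using ev eventually_ge_at_top[of x] by eventually_elim simp
      then obtain y where "measure \<mu> {y<..} > 0" "y \<ge> x"
        using eventually_happens trivial_limit_at_top_linorder by blast
      then show ?thesis
        using tail_antimono[OF \<mu>, of x y] x by simp
    qed
    have "((\<lambda>x. measure \<mu> {c * x<..} / measure \<mu> {x<..}) \<longlongrightarrow> c powr - \<alpha>) at_top" if c: "c > 0" for c
    proof -
      have scale: "filterlim (\<lambda>x. c * x) at_top at_top"
        using c by (intro filterlim_tendsto_pos_mult_at_top[OF tendsto_const _ filterlim_ident])
      have "((\<lambda>x. measure \<mu> {c * x<..} / l (c * x) * (l (c * x) / l x) / (measure \<mu> {x<..} / l x)) \<longlongrightarrow>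
          1 * c powr - \<alpha> / 1) at_top"
        by (intro tendsto_divide tendsto_mult filterlim_compose[OF lim scale] l_rv c lim) simp
      moreover have "\<forall>\<^sub>F x in at_top. measure \<mu> {c * x<..} / l (c * x) * (l (c * x) / l x) /
          (measure \<mu> {x<..} / l x) = measure \<mu> {c * x<..} / measure \<mu> {x<..}"
        using ev eventually_compose_filterlim[OF ev scale] by eventually_elim simp
      ultimately have "((\<lambda>x. measure \<mu> {c * x<..} / measure \<mu> {x<..}) \<longlongrightarrow> 1 * c powr - \<alpha> / 1) at_top"
        by (rule Lim_transform_eventually)
      then show ?thesis by simp
    qed
    then have "((\<lambda>x. stieltjes \<mu> x / measure \<mu> {x<..}) \<longlongrightarrow> pi * \<alpha> / sin (pi * \<alpha>)) at_top"
      by (intro stieltjes_abelian[OF \<mu> \<alpha>] pos)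
    from tendsto_mult[OF this lim]
    have "((\<lambda>x. stieltjes \<mu> x / measure \<mu> {x<..} * (measure \<mu> {x<..} / l x)) \<longlongrightarrow>
        pi * \<alpha> / sin (pi * \<alpha>)) at_top" by simp
    moreover have "\<forall>\<^sub>F x in at_top. stieltjes \<mu> x / measure \<mu> {x<..} * (measure \<mu> {x<..} / l x) =
        stieltjes \<mu> x / l x"
      using ev by eventually_elim simp
    ultimately show "((\<lambda>x. stieltjes \<mu> x / l x) \<longlongrightarrow> pi * \<alpha> / sin (pi * \<alpha>)) at_top"
      by (rule Lim_transform_eventually)
  qed
qed

text \<open>Strict monotonicity of \<open>stieltjes \<mu>\<close> makes \<open>psi_transform \<mu>\<close> injective on the negative axis, so
  \<open>chi_transform \<mu>\<close> really inverts it.\<close>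

lemma chi_transform_stieltjes:
  assumes "\<mu> \<in> M_plus" "\<mu> \<noteq> return nonneg_borel 0" "x > 0"
  shows "chi_transform \<mu> (- stieltjes \<mu> x) = - 1 / x"
proof -
  have "inj_on (psi_transform \<mu>) {..<0}"
  proof (rule linorder_inj_onI)
    fix y z :: real assume yz: "y < z" "y \<in> {..<0}" "z \<in> {..<0}"
    have "stieltjes \<mu> (- 1 / z) < stieltjes \<mu> (- 1 / y)"
      using yz by (intro stieltjes_strict_antimono assms) (auto simp: field_simps)
    moreover have "psi_transform \<mu> w = - stieltjes \<mu> (- 1 / w)" if "w < 0" for w
      using psi_transform_eq_stieltjes[of "- 1 / w" \<mu>] that by simp
    ultimately show "psi_transform \<mu> y \<noteq> psi_transform \<mu> z"
      using yz by simp
  qed auto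
  then show ?thesis
    unfolding chi_transform_def
    using psi_transform_eq_stieltjes[OF assms(3), of \<mu>] assms(3)
    by (intro the_inv_into_f_eq) auto
qed

lemma strict_mono_on_inverse:
  fixes f g :: "real \<Rightarrow> real"
  assumes "strict_mono_on {a..} f" and "\<And>y. y \<ge> b \<Longrightarrow> g y \<ge> a \<and> f (g y) = y"
  shows "strict_mono_on {b..} g"
proof (rule strict_mono_onI)
  fix y z assume yz: "y \<in> {b..}" "z \<in> {b..}" "y < z"
  show "g y < g z"
  proof (rule ccontr)
    assume "\<not> g y < g z"
    then have "f (g z) \<le> f (g y)"
      using assms(2) yz by (intro strict_mono_on_leD[OF assms(1)]) auto
    then show False
      using assms(2) yz by auto
  qed
qed

theorem theorem4p5:
  fixes \<mu> :: "real measure" and \<alpha> :: real and L M Msharp :: "real \<Rightarrow> real"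
  assumes "\<mu> \<in> M_plus"
    and "\<mu> \<noteq> return nonneg_borel 0"
    and "0 < \<alpha>" and "\<alpha> < 1"
    and "slowly_varying L"
    and "M = (\<lambda>x. L x powr (- 1 / \<alpha>))"
    and "de_bruijn_conjugate M Msharp"
  shows "(\<lambda>x. measure \<mu> {x<..}) \<sim>[at_top] (\<lambda>x. x powr (- \<alpha>) * L x) \<longleftrightarrow>
         (\<lambda>x. S_transform \<mu> (- 1 / x)) \<sim>[at_top]
           (\<lambda>x. (sin (pi * \<alpha>) / (pi * \<alpha>)) powr (1 / \<alpha>) *
                (x powr (1 - 1 / \<alpha>) / Msharp (x powr (1 / \<alpha>))))"
proof -
  note \<mu> = assms(1,2) and \<alpha> = assms(3,4)
  define c where "c = pi * \<alpha> / sin (pi * \<alpha>)"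
  have "sin (pi * \<alpha>) > 0"
    using \<alpha> by (intro sin_gt_zero) auto
  then have c: "c > 0"
    using \<alpha> by (simp add: c_def)
  define k where "k = c powr (- 1 / \<alpha>)"
  have k: "k > 0"
    using c by (simp add: k_def)
  have k_eq: "(sin (pi * \<alpha>) / (pi * \<alpha>)) powr (1 / \<alpha>) = k"
  proof -
    have "sin (pi * \<alpha>) / (pi * \<alpha>) = inverse c"
      by (simp add: c_def)
    then show ?thesis
      using c by (simp add: k_def powr_minus inverse_powr)
  qed
  \<comment> \<open>The power \<open>-1/\<alpha>\<close> changes regular variation of index \<open>-\<alpha>\<close> into index \<open>1\<close>, the setting of de Bruijn conjugates.\<close>
  define h where "h = (\<lambda>x. stieltjes \<mu> x powr (- 1 / \<alpha>))"
  \<comment> \<open>The inverse of \<open>h\<close>, expressed through \<open>chi_transform\<close>: \<open>h x = z\<close> means \<open>\<psi>(-1/x) = -z\<^sup>-\<^sup>\<alpha>\<close>.\<close>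
  define g where "g = (\<lambda>z. - 1 / chi_transform \<mu> (- (z powr - \<alpha>)))"
  have h_powr: "h x powr - \<alpha> = stieltjes \<mu> x" if "x > 0" for x
    using stieltjes_pos[OF \<mu> that] \<alpha> by (simp add: h_def powr_powr)
  have h_mono: "strict_mono_on {1..} h"
  proof (rule strict_mono_onI)
    fix x y :: real assume xy: "x \<in> {1..}" "y \<in> {1..}" "x < y"
    then show "h x < h y"
      unfolding h_def using stieltjes_pos[OF \<mu>, of y] stieltjes_strict_antimono[OF \<mu>, of x y] \<alpha>
      by (intro powr_less_mono2_neg) auto
  qed
  have g_h: "g (h x) = x" if "x > 0" for x
    using chi_transform_stieltjes[OF \<mu> that] h_powr[OF that] that by (simp add: g_def)
  have h_g: "g z \<ge> 1 \<and> h (g z) = z" if z: "z \<ge> h 1" for z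
  proof -
    have h1: "h 1 > 0"
      using stieltjes_pos[OF \<mu>, of 1] by (simp add: h_def)
    then have "z powr - \<alpha> \<le> h 1 powr - \<alpha>"
      using z \<alpha> by (intro powr_mono2') auto
    then obtain x where x: "x \<ge> 1" "stieltjes \<mu> x = z powr - \<alpha>"
      using stieltjes_surj[OF \<mu>, of "z powr - \<alpha>"] z h1 h_powr[of 1] by auto
    moreover have "z > 0"
      using z h1 by linarith
    ultimately have "h x = z"
      using \<alpha> by (simp add: h_def powr_powr)
    then show ?thesis
      using g_h[of x] x by auto
  qed
  have g_mono: "strict_mono_on {h 1..} g"
    by (rule strict_mono_on_inverse[OF h_mono h_g])
  have h_ge: "h x \<ge> h 1 \<and> g (h x) = x" if "x \<ge> 1" for x
    using strict_mono_on_leD[OF h_mono] g_h that by auto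
  have conj: "de_bruijn_conjugate Msharp M"
    using assms(7) by (auto simp: de_bruijn_conjugate_def)
  have L_pos: "\<forall>\<^sub>F x in at_top. L x > 0"
    by (rule slowly_varying_eventually_pos[OF assms(5)])
  have N_pos: "\<forall>\<^sub>F z in at_top. Msharp z > 0"
    using assms(7) by (intro slowly_varying_eventually_pos) (simp add: de_bruijn_conjugate_def)

  have "(\<lambda>x. measure \<mu> {x<..}) \<sim>[at_top] (\<lambda>x. x powr (- \<alpha>) * L x) \<longleftrightarrow>
      ((\<lambda>x. measure \<mu> {x<..} / (x powr - \<alpha> * L x)) \<longlongrightarrow> 1) at_top"
  proof (rule asymp_equiv_iff_quotient)
    show "\<forall>\<^sub>F x in at_top. x powr - \<alpha> * L x \<noteq> 0"
      using L_pos eventually_gt_at_top[of 0] by eventually_elim simp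
  qed
  also have "\<dots> \<longleftrightarrow> ((\<lambda>x. stieltjes \<mu> x / (x powr - \<alpha> * L x)) \<longlongrightarrow> c) at_top"
    unfolding c_def by (rule tail_iff_stieltjes[OF \<mu>(1) \<alpha> assms(5)])
  also have "\<dots> \<longleftrightarrow> ((\<lambda>x. (stieltjes \<mu> x / (x powr - \<alpha> * L x)) powr (- 1 / \<alpha>)) \<longlongrightarrow> k) at_top"
    unfolding k_def
  proof (rule tendsto_powr_iff[symmetric])
    show "\<forall>\<^sub>F x in at_top. stieltjes \<mu> x / (x powr - \<alpha> * L x) > 0"
      using L_pos eventually_gt_at_top[of 0]
      by eventually_elim (use stieltjes_pos[OF \<mu>] in simp)
  qed (use c \<alpha> in auto)
  also have "\<dots> \<longleftrightarrow> ((\<lambda>x. h x / (x * M x)) \<longlongrightarrow> k) at_top"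
  proof (rule filterlim_cong[OF refl refl])
    show "\<forall>\<^sub>F x in at_top. (stieltjes \<mu> x / (x powr - \<alpha> * L x)) powr (- 1 / \<alpha>) = h x / (x * M x)"
      using L_pos eventually_gt_at_top[of 0]
      by eventually_elim
        (use stieltjes_pos[OF \<mu>] \<alpha> in \<open>simp add: powr_divide powr_mult powr_powr h_def assms(6)\<close>)
  qed
  also have "\<dots> \<longleftrightarrow> ((\<lambda>z. g z / (z * Msharp z)) \<longlongrightarrow> 1 / k) at_top"
  proof
    assume lim: "((\<lambda>x. h x / (x * M x)) \<longlongrightarrow> k) at_top"
    show "((\<lambda>z. g z / (z * Msharp z)) \<longlongrightarrow> 1 / k) at_top"
      by (rule inverse_asymptotics[OF assms(7) k h_mono _ lim]) (rule h_g)
  next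
    assume lim: "((\<lambda>z. g z / (z * Msharp z)) \<longlongrightarrow> 1 / k) at_top"
    have "((\<lambda>x. h x / (x * M x)) \<longlongrightarrow> 1 / (1 / k)) at_top"
      by (rule inverse_asymptotics[OF conj _ g_mono _ lim]) (use k h_ge in simp_all)
    then show "((\<lambda>x. h x / (x * M x)) \<longlongrightarrow> k) at_top" by simp
  qed
  also have "\<dots> \<longleftrightarrow> ((\<lambda>x. S_transform \<mu> (- 1 / x) /
      (k * (x powr (1 - 1 / \<alpha>) / Msharp (x powr (1 / \<alpha>))))) \<longlongrightarrow> 1) at_top"
    (is "(?R \<longlongrightarrow> _) _ \<longleftrightarrow> (?Q \<longlongrightarrow> _) _")
  proof -
    have root_top: "filterlim (\<lambda>x. x powr (1 / \<alpha>)) at_top (at_top :: real filter)"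
      using \<alpha> by (intro filterlim_powr_at_top) auto
    have pow_top: "filterlim (\<lambda>x. x powr \<alpha>) at_top (at_top :: real filter)"
      using \<alpha> by (intro filterlim_powr_at_top) auto
    have small: "((\<lambda>x. 1 - 1 / x) \<longlongrightarrow> 1 - 0) (at_top :: real filter)"
      by (intro tendsto_diff tendsto_const tendsto_divide_0[OF tendsto_const]
          filterlim_at_top_imp_at_infinity filterlim_ident)
    have R_pos: "\<forall>\<^sub>F z in at_top. ?R z > 0 \<and> Msharp z > 0 \<and> g z > 0 \<and> z > 0"
      using N_pos eventually_gt_at_top[of 0] eventually_ge_at_top[of "h 1"]
    proof eventually_elim
      case (elim z)
      then have "g z > 0" using h_g[of z] by simp
      then show ?case using elim by simp
    qed
    have Q_eq: "\<forall>\<^sub>F x in at_top. ?Q x = (1 - 1 / x) / (k * ?R (x powr (1 / \<alpha>)))"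
      using eventually_compose_filterlim[OF R_pos root_top] eventually_gt_at_top[of 0]
    proof eventually_elim
      case (elim x)
      define z where "z = x powr (1 / \<alpha>)"
      have "z powr - \<alpha> = 1 / x"
        using elim(2) \<alpha> by (simp add: z_def powr_powr powr_minus_divide)
      then have chi: "chi_transform \<mu> (- 1 / x) = - 1 / g z"
        by (simp add: g_def)
      have z: "z > 0" "Msharp z > 0" "g z > 0"
        using elim by (auto simp: z_def)
      have quot: "x powr (1 - 1 / \<alpha>) = x / z"
        using elim(2) by (simp add: z_def powr_diff)
      then show ?case
        unfolding S_transform_def chi z_def[symmetric] quot
        using elim(2) z k by (simp add: field_simps)
    qed
    show ?thesis
    proof
      assume R: "(?R \<longlongrightarrow> 1 / k) at_top"
      have "((\<lambda>x. (1 - 1 / x) / (k * ?R (x powr (1 / \<alpha>)))) \<longlongrightarrow> (1 - 0) / (k * (1 / k))) at_top"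
        using k by (intro tendsto_divide small tendsto_mult tendsto_const filterlim_compose[OF R root_top]) auto
      then have "((\<lambda>x. (1 - 1 / x) / (k * ?R (x powr (1 / \<alpha>)))) \<longlongrightarrow> 1) at_top"
        using k by simp
      then show "(?Q \<longlongrightarrow> 1) at_top"
        using Q_eq by (subst filterlim_cong[OF refl refl])
    next
      assume "(?Q \<longlongrightarrow> 1) at_top"
      then have "((\<lambda>x. (1 - 1 / x) / (k * ?R (x powr (1 / \<alpha>)))) \<longlongrightarrow> 1) at_top"
        using Q_eq by (rule Lim_transform_eventually)
      from filterlim_compose[OF this pow_top]
      have "((\<lambda>z. (1 - 1 / z powr \<alpha>) / (k * ?R ((z powr \<alpha>) powr (1 / \<alpha>)))) \<longlongrightarrow> 1) at_top" .
      from tendsto_divide[OF filterlim_compose[OF small pow_top] tendsto_mult[OF tendsto_const this], of k]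
      have "((\<lambda>z. (1 - 1 / z powr \<alpha>) /
          (k * ((1 - 1 / z powr \<alpha>) / (k * ?R ((z powr \<alpha>) powr (1 / \<alpha>)))))) \<longlongrightarrow> 1 / k) at_top"
        using k by simp
      moreover have "\<forall>\<^sub>F z in at_top. (1 - 1 / z powr \<alpha>) /
          (k * ((1 - 1 / z powr \<alpha>) / (k * ?R ((z powr \<alpha>) powr (1 / \<alpha>))))) = ?R z"
        using R_pos eventually_gt_at_top[of 1]
      proof eventually_elim
        case (elim z)
        have "z powr \<alpha> > 1"
          using elim \<alpha> by (simp add: gr_one_powr)
        then have nonzero: "1 - 1 / z powr \<alpha> \<noteq> 0"
          using elim \<alpha> by simp
        have root: "(z powr \<alpha>) powr (1 / \<alpha>) = z"
          using elim \<alpha> by (simp add: powr_powr)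
        have cancel: "a / (k * (a / (k * b))) = b" if "a \<noteq> 0" for a b
          using that k by simp
        show ?case
          unfolding root by (rule cancel[OF nonzero])
      qed
      ultimately show "(?R \<longlongrightarrow> 1 / k) at_top"
        by (rule Lim_transform_eventually)
    qed
  qed
  also have "\<dots> \<longleftrightarrow> (\<lambda>x. S_transform \<mu> (- 1 / x)) \<sim>[at_top]
      (\<lambda>x. k * (x powr (1 - 1 / \<alpha>) / Msharp (x powr (1 / \<alpha>))))"
  proof (rule asymp_equiv_iff_quotient[symmetric])
    have "filterlim (\<lambda>x. x powr (1 / \<alpha>)) at_top (at_top :: real filter)"
      using \<alpha> by (intro filterlim_powr_at_top) auto
    from eventually_compose_filterlim[OF N_pos this] eventually_gt_at_top[of 0]
    show "\<forall>\<^sub>F x in at_top. k * (x powr (1 - 1 / \<alpha>) / Msharp (x powr (1 / \<alpha>))) \<noteq> 0"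
      by eventually_elim (use k in simp)
  qed
  finally show ?thesis
    unfolding k_eq .
qed

end
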